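(* Let $\Delta$ be an $\omega$-categorical structure with countably infinite domain $D$. Then the monoid of all self-embeddings of $\Delta$, as a closed submonoid of the monoid $\mathbf O^{(1)}$ of all functions $D\to D$, does not have automatic continuity.
   Context: A countable first-order structure $\Delta$ is $\omega$-categorical if all countable models of its first-order theory are isomorphic to $\Delta$. A self-embedding of $\Delta$ is an embedding of $\Delta$ into itself (an injective map preserving the functions and constants and preserving and reflecting all relations). $\mathbf O^{(1)}$ denotes the monoid of all functions from a countably infinite set to itself under composition, with the topology of pointwise convergence (domain discrete). A closed submonoid $M$ of $\mathbf O^{(1)}$ has automatic continuity if every monoid homomorphism from $M$ into $\mathbf O^{(1)}$ is continuous.
   Formalization: The signature of the structure is assumed countable, as is customary for ω-categoricity; without this the claim fails, e.g. for the countable structure naming all finitary relations on its domain, whose only self-embedding is the identity. *)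

theory Defs
  imports "HOL-Algebra.Group" "HOL-Analysis.Function_Topology" "HOL-Library.Countable_Set"
begin

section \<open>First-order logic with equality\<close>

text \<open>The symbols are given as sets inside the types \<open>'f\<close> and \<open>'r\<close>, so that for instance
  signatures without function symbols are included. Constants are function symbols of arity 0.\<close>

record ('f, 'r) signature =
  funs :: "'f set"
  rels :: "'r set"
  fun_arity :: "'f \<Rightarrow> nat"
  rel_arity :: "'r \<Rightarrow> nat"

definition countable_signature :: "('f, 'r) signature \<Rightarrow> bool" where
  "countable_signature S \<longleftrightarrow> countable (funs S) \<and> countable (rels S)"

datatype 'f trm = Var nat | Fun 'f "'f trm list"

datatype ('f, 'r) form =
    Bot
  | Eq "'f trm" "'f trm"
  | Rel 'r "'f trm list"
  | Imp "('f, 'r) form" "('f, 'r) form"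
  | All nat "('f, 'r) form"

primrec vars_trm :: "'f trm \<Rightarrow> nat set" where
  "vars_trm (Var x) = {x}"
| "vars_trm (Fun f ts) = \<Union> (set (map vars_trm ts))"

primrec free_vars :: "('f, 'r) form \<Rightarrow> nat set" where
  "free_vars Bot = {}"
| "free_vars (Eq s t) = vars_trm s \<union> vars_trm t"
| "free_vars (Rel r ts) = (\<Union>t\<in>set ts. vars_trm t)"
| "free_vars (Imp p q) = free_vars p \<union> free_vars q"
| "free_vars (All x p) = free_vars p - {x}"

primrec wf_trm :: "('f, 'r) signature \<Rightarrow> 'f trm \<Rightarrow> bool" where
  "wf_trm S (Var x) \<longleftrightarrow> True"
| "wf_trm S (Fun f ts) \<longleftrightarrow> f \<in> funs S \<and> length ts = fun_arity S f \<and> list_all (wf_trm S) ts"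

primrec wf_form :: "('f, 'r) signature \<Rightarrow> ('f, 'r) form \<Rightarrow> bool" where
  "wf_form S Bot \<longleftrightarrow> True"
| "wf_form S (Eq s t) \<longleftrightarrow> wf_trm S s \<and> wf_trm S t"
| "wf_form S (Rel r ts) \<longleftrightarrow> r \<in> rels S \<and> length ts = rel_arity S r \<and> list_all (wf_trm S) ts"
| "wf_form S (Imp p q) \<longleftrightarrow> wf_form S p \<and> wf_form S q"
| "wf_form S (All x p) \<longleftrightarrow> wf_form S p"

definition sentence :: "('f, 'r) signature \<Rightarrow> ('f, 'r) form \<Rightarrow> bool" where
  "sentence S p \<longleftrightarrow> wf_form S p \<and> free_vars p = {}"

text \<open>The values of \<open>fun_of\<close> and \<open>rel_of\<close> only matter for symbols of the signature and
  for lists over the domain whose length is the arity.\<close>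

record ('f, 'r, 'a) struct =
  universe :: "'a set"
  fun_of :: "'f \<Rightarrow> 'a list \<Rightarrow> 'a"
  rel_of :: "'r \<Rightarrow> 'a list \<Rightarrow> bool"

definition tuples :: "'a set \<Rightarrow> nat \<Rightarrow> 'a list set" where
  "tuples X n = {xs. set xs \<subseteq> X \<and> length xs = n}"

definition is_struct :: "('f, 'r) signature \<Rightarrow> ('f, 'r, 'a) struct \<Rightarrow> bool" where
  "is_struct S A \<longleftrightarrow> universe A \<noteq> {} \<and>
     (\<forall>f\<in>funs S. \<forall>xs\<in>tuples (universe A) (fun_arity S f). fun_of A f xs \<in> universe A)"

primrec val :: "('f, 'r, 'a) struct \<Rightarrow> (nat \<Rightarrow> 'a) \<Rightarrow> 'f trm \<Rightarrow> 'a" where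
  "val A v (Var x) = v x"
| "val A v (Fun f ts) = fun_of A f (map (val A v) ts)"

primrec sat :: "('f, 'r, 'a) struct \<Rightarrow> (nat \<Rightarrow> 'a) \<Rightarrow> ('f, 'r) form \<Rightarrow> bool" where
  "sat A v Bot \<longleftrightarrow> False"
| "sat A v (Eq s t) \<longleftrightarrow> val A v s = val A v t"
| "sat A v (Rel r ts) \<longleftrightarrow> rel_of A r (map (val A v) ts)"
| "sat A v (Imp p q) \<longleftrightarrow> (sat A v p \<longrightarrow> sat A v q)"
| "sat A v (All x p) \<longleftrightarrow> (\<forall>a\<in>universe A. sat A (v(x := a)) p)"

definition holds :: "('f, 'r, 'a) struct \<Rightarrow> ('f, 'r) form \<Rightarrow> bool" where
  "holds A p \<longleftrightarrow> (\<forall>v. range v \<subseteq> universe A \<longrightarrow> sat A v p)"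

definition theory_of :: "('f, 'r) signature \<Rightarrow> ('f, 'r, 'a) struct \<Rightarrow> ('f, 'r) form set" where
  "theory_of S A = {p. sentence S p \<and> holds A p}"

definition is_model :: "('f, 'r) signature \<Rightarrow> ('f, 'r) form set \<Rightarrow> ('f, 'r, 'a) struct \<Rightarrow> bool" where
  "is_model S T A \<longleftrightarrow> is_struct S A \<and> (\<forall>p\<in>T. holds A p)"


section \<open>Embeddings and countable categoricity\<close>

definition embedding ::
  "('f, 'r) signature \<Rightarrow> ('f, 'r, 'a) struct \<Rightarrow> ('f, 'r, 'b) struct \<Rightarrow> ('a \<Rightarrow> 'b) \<Rightarrow> bool" where
  "embedding S A B h \<longleftrightarrow> h \<in> universe A \<rightarrow> universe B \<and> inj_on h (universe A) \<and>
     (\<forall>f\<in>funs S. \<forall>xs\<in>tuples (universe A) (fun_arity S f). h (fun_of A f xs) = fun_of B f (map h xs)) \<and>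
     (\<forall>r\<in>rels S. \<forall>xs\<in>tuples (universe A) (rel_arity S r). rel_of A r xs \<longleftrightarrow> rel_of B r (map h xs))"

definition isomorphic ::
  "('f, 'r) signature \<Rightarrow> ('f, 'r, 'a) struct \<Rightarrow> ('f, 'r, 'b) struct \<Rightarrow> bool" where
  "isomorphic S A B \<longleftrightarrow> (\<exists>h. embedding S A B h \<and> h ` universe A = universe B)"

text \<open>The models range over structures whose domain is a set of natural numbers. This covers
  all countable models up to isomorphism; see \<open>omega_categorical_isomorphic\<close> below.\<close>

definition omega_categorical :: "('f, 'r) signature \<Rightarrow> ('f, 'r, 'a) struct \<Rightarrow> bool" where
  "omega_categorical S A \<longleftrightarrow>
     (\<forall>B :: ('f, 'r, nat) struct. is_model S (theory_of S A) B \<longrightarrow> isomorphic S B A)"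

lemma embedding_val:
  assumes e: "embedding S A B h" and A: "is_struct S A" and v: "range v \<subseteq> universe A"
  shows "wf_trm S t \<Longrightarrow> val A v t \<in> universe A \<and> h (val A v t) = val B (\<lambda>x. h (v x)) t"
proof (induction t)
  case (Var x)
  then show ?case using v by auto
next
  case (Fun f ts)
  have IH: "\<And>t. t \<in> set ts \<Longrightarrow> val A v t \<in> universe A \<and> h (val A v t) = val B (\<lambda>x. h (v x)) t"
    using Fun by (auto simp: list_all_iff)
  have f: "f \<in> funs S" using Fun.prems by simp
  have "map (val A v) ts \<in> tuples (universe A) (fun_arity S f)"
    using IH Fun.prems by (auto simp: tuples_def)
  moreover have "map h (map (val A v) ts) = map (val B (\<lambda>x. h (v x))) ts"
    using IH by simp
  ultimately show ?case using e A f by (simp add: embedding_def is_struct_def del: map_map)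
qed

lemma isomorphism_sat:
  assumes e: "embedding S A B h" and s: "h ` universe A = universe B" and A: "is_struct S A"
  shows "wf_form S p \<Longrightarrow> range v \<subseteq> universe A \<Longrightarrow> sat A v p \<longleftrightarrow> sat B (\<lambda>x. h (v x)) p"
proof (induction p arbitrary: v)
  case (Eq t u)
  have wf: "wf_trm S t" "wf_trm S u" using Eq.prems by simp_all
  note t = embedding_val[OF e A Eq.prems(2) wf(1)] and u = embedding_val[OF e A Eq.prems(2) wf(2)]
  have "inj_on h (universe A)" using e by (simp add: embedding_def)
  then have "val A v t = val A v u \<longleftrightarrow> h (val A v t) = h (val A v u)"
    using t u by (metis inj_onD)
  then show ?case using t u by simp
next
  case (Rel r ts)
  have IH: "\<And>t. t \<in> set ts \<Longrightarrow> val A v t \<in> universe A \<and> h (val A v t) = val B (\<lambda>x. h (v x)) t"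
    using embedding_val[OF e A Rel.prems(2)] Rel.prems(1) by (auto simp: list_all_iff)
  have "map (val A v) ts \<in> tuples (universe A) (rel_arity S r)"
    using IH Rel.prems by (auto simp: tuples_def)
  moreover have "r \<in> rels S" using Rel.prems by simp
  ultimately have "rel_of A r (map (val A v) ts) \<longleftrightarrow> rel_of B r (map h (map (val A v) ts))"
    using e unfolding embedding_def by blast
  also have "map h (map (val A v) ts) = map (val B (\<lambda>x. h (v x))) ts"
    using IH by simp
  finally show ?case by simp
next
  case (All x p)
  have "sat A (v(x := a)) p \<longleftrightarrow> sat B ((\<lambda>y. h (v y))(x := h a)) p" if "a \<in> universe A" for a
  proof -
    have "range (v(x := a)) \<subseteq> universe A" using All.prems that by auto
    then have "sat A (v(x := a)) p \<longleftrightarrow> sat B (\<lambda>y. h ((v(x := a)) y)) p"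
      using All by simp
    moreover have "(\<lambda>y. h ((v(x := a)) y)) = (\<lambda>y. h (v y))(x := h a)" by auto
    ultimately show ?thesis by simp
  qed
  then show ?case unfolding sat.simps s[symmetric] by simp
qed auto

lemma embedding_compose:
  assumes "embedding S A B g" "embedding S B C h"
  shows "embedding S A C (h \<circ> g)"
proof -
  have g: "g \<in> universe A \<rightarrow> universe B" using assms(1) by (simp add: embedding_def)
  then have "map g xs \<in> tuples (universe B) n" if "xs \<in> tuples (universe A) n" for xs n
    using that by (auto simp: tuples_def)
  moreover have "inj_on (h \<circ> g) (universe A)"
    using assms g by (auto simp: embedding_def inj_on_def Pi_iff)
  ultimately show ?thesis using assms by (auto simp: embedding_def Pi_iff)
qed

text \<open>Countable models of arbitrary type.\<close>

lemma omega_categorical_isomorphic: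
  fixes A :: "('f, 'r, 'a) struct" and B :: "('f, 'r, 'b) struct"
  assumes cat: "omega_categorical S A" and B: "is_model S (theory_of S A) B"
    and count: "countable (universe B)"
  shows "isomorphic S B A"
proof -
  define g where "g = to_nat_on (universe B)"
  define k where "k = from_nat_into (universe B)"
  have inj: "inj_on g (universe B)" unfolding g_def by (rule inj_on_to_nat_on[OF count])
  have kg: "k (g x) = x" if "x \<in> universe B" for x using count that by (simp add: k_def g_def)
  define N :: "('f, 'r, nat) struct" where
    "N = \<lparr>universe = g ` universe B, fun_of = \<lambda>f xs. g (fun_of B f (map k xs)),
          rel_of = \<lambda>r xs. rel_of B r (map k xs)\<rparr>"
  have Bs: "is_struct S B" using B by (simp add: is_model_def)
  have mk: "map k (map g xs) = xs" if "xs \<in> tuples (universe B) n" for xs n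
    using that kg by (auto simp: tuples_def intro!: map_idI)
  have e: "embedding S B N g"
    unfolding embedding_def using inj mk by (auto simp: N_def simp del: map_map)
  have s: "g ` universe B = universe N" by (simp add: N_def)
  have Ns: "is_struct S N"
  proof -
    have "map k xs \<in> tuples (universe B) n" if "xs \<in> tuples (g ` universe B) n" for xs n
      using that kg by (force simp: tuples_def)
    then show ?thesis using Bs by (auto simp: is_struct_def N_def)
  qed
  have "holds N p" if p: "p \<in> theory_of S A" for p
    unfolding holds_def
  proof (intro allI impI)
    fix v :: "nat \<Rightarrow> nat" assume v: "range v \<subseteq> universe N"
    have kv: "range (\<lambda>x. k (v x)) \<subseteq> universe B"
      using v kg by (fastforce simp: N_def)
    have gkv: "(\<lambda>x. g (k (v x))) = v"
    proof
      fix x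
      have "v x \<in> g ` universe B" using v by (auto simp: N_def)
      then show "g (k (v x)) = v x" using kg by auto
    qed
    have "sat B (\<lambda>x. k (v x)) p" using B p kv by (auto simp: is_model_def holds_def)
    moreover have "wf_form S p" using p by (simp add: theory_of_def sentence_def)
    ultimately show "sat N v p" using isomorphism_sat[OF e s Bs _ kv] gkv by simp
  qed
  then have "isomorphic S N A"
    using cat Ns by (auto simp: omega_categorical_def is_model_def)
  then obtain h where h: "embedding S N A h" "h ` universe N = universe A"
    by (auto simp: isomorphic_def)
  then have "embedding S B A (h \<circ> g)" "(h \<circ> g) ` universe B = universe A"
    using embedding_compose[OF e] s unfolding image_comp[symmetric] by simp_all
  then show ?thesis unfolding isomorphic_def by blast
qed


section \<open>The monoid of all self-maps and automatic continuity\<close>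

text \<open>Self-maps of \<open>D\<close> are represented by extensional functions, as in \<^const>\<open>PiE\<close>.\<close>

definition self_maps :: "'a set \<Rightarrow> ('a \<Rightarrow> 'a) monoid" where
  "self_maps D = \<lparr>carrier = D \<rightarrow>\<^sub>E D, mult = compose D, one = (\<lambda>x\<in>D. x)\<rparr>"

definition pointwise :: "'a set \<Rightarrow> ('a \<Rightarrow> 'a) topology" where
  "pointwise D = product_topology (\<lambda>_. discrete_topology D) D"

definition closed_submonoid :: "'a set \<Rightarrow> ('a \<Rightarrow> 'a) set \<Rightarrow> bool" where
  "closed_submonoid D M \<longleftrightarrow> submonoid M (self_maps D) \<and> closedin (pointwise D) M"

text \<open>\<^const>\<open>hom\<close> only requires compatibility with multiplication.\<close>

definition monoid_homs :: "('a, 'm) monoid_scheme \<Rightarrow> ('b, 'n) monoid_scheme \<Rightarrow> ('a \<Rightarrow> 'b) set" where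
  "monoid_homs M N = {\<phi> \<in> hom M N. \<phi> \<one>\<^bsub>M\<^esub> = \<one>\<^bsub>N\<^esub>}"

definition automatic_continuity :: "'a set \<Rightarrow> ('a \<Rightarrow> 'a) set \<Rightarrow> bool" where
  "automatic_continuity D M \<longleftrightarrow>
     (\<forall>\<phi> \<in> monoid_homs (self_maps D\<lparr>carrier := M\<rparr>) (self_maps D).
        continuous_map (subtopology (pointwise D) M) (pointwise D) \<phi>)"

definition self_embeddings :: "('f, 'r) signature \<Rightarrow> ('f, 'r, 'a) struct \<Rightarrow> ('a \<Rightarrow> 'a) set" where
  "self_embeddings S A = {h \<in> universe A \<rightarrow>\<^sub>E universe A. embedding S A A h}"

end

theory Submission
  imports Defs
begin

text \<open>The monoid of self-embeddings is defined by conditions on finitely many arguments each, hence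
  closed. For the failure of automatic continuity, let \<open>M\<close> be this monoid. Its members are
  injective, so a composition is surjective precisely if both factors are. Sending the surjective members
  to the identity and all others to a constant map is thus a homomorphism. It is discontinuous as
  soon as some nonsurjective self-embedding is a pointwise limit of automorphisms
  (\<open>not_automatic_continuity\<close>).

  The model theory lies in producing such a limit (\<open>nonsurjective_limit_of_automorphisms\<close>).
  The idea is to find one countable model of the theory of \<open>\<Delta>\<close> with the wanted
  properties; by \<open>\<omega>\<close>-categoricity \<open>\<Delta>\<close> is isomorphic to it. This model is taken inside an ultrapower of \<open>\<Delta>\<close> over
  the natural numbers. The ultrapower is saturated for countable sets of formulas and therefore
  homogeneous (\<open>homogeneous_ultrapower\<close>): if two finite tuples have the same complete type, then any
  extension of one by an element can be matched by an extension of the other. It also properly contains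
  \<open>\<Delta>\<close> as an elementary substructure. A Loewenheim-Skolem argument
  (\<open>homogeneous_elementary_substructure\<close>) provides a countable homogeneous elementary substructure that is still
  a proper extension of the diagonal copy of \<open>\<Delta>\<close>.

  Transporting along an isomorphism from this model to \<open>\<Delta>\<close> shows that \<open>\<Delta>\<close> is homogeneous and has
  a nonsurjective elementary self-embedding \<open>f\<close>. For every finite tuple \<open>c\<close>, the tuples \<open>c\<close> and \<open>f c\<close> have
  the same type, so by back and forth some automorphism maps \<open>c\<close> to \<open>f c\<close>
  (\<open>homogeneous_automorphism\<close>). Hence \<open>f\<close> is a limit of automorphisms.\<close>

section \<open>Ultrafilters\<close>

text \<open>Filters are used instead of families of sets: a finer filter is a smaller one, so an
  ultrafilter is a minimal proper filter, in the form of a filter that decides every predicate.\<close>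

definition ultra :: "'i filter \<Rightarrow> bool" where
  "ultra F \<longleftrightarrow> F \<noteq> bot \<and> (\<forall>P. eventually P F \<or> eventually (\<lambda>i. \<not> P i) F)"

lemma ultra_eventually_not:
  assumes "ultra F"
  shows "eventually (\<lambda>i. \<not> P i) F \<longleftrightarrow> \<not> eventually P F"
proof
  assume "eventually (\<lambda>i. \<not> P i) F"
  then have "eventually (\<lambda>_. False) F" if "eventually P F"
    using that by eventually_elim simp
  then show "\<not> eventually P F"
    using assms by (auto simp: ultra_def trivial_limit_def)
qed (use assms in \<open>auto simp: ultra_def\<close>)

lemma ultra_eventually_imp:
  assumes "ultra F"
  shows "eventually (\<lambda>i. P i \<longrightarrow> Q i) F \<longleftrightarrow> (eventually P F \<longrightarrow> eventually Q F)"
proof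
  assume "eventually (\<lambda>i. P i \<longrightarrow> Q i) F"
  then show "eventually P F \<longrightarrow> eventually Q F"
    by (auto elim: eventually_mp)
next
  assume "eventually P F \<longrightarrow> eventually Q F"
  then consider "eventually Q F" | "eventually (\<lambda>i. \<not> P i) F"
    using ultra_eventually_not[OF assms] by blast
  then show "eventually (\<lambda>i. P i \<longrightarrow> Q i) F"
    by cases (auto elim: eventually_mono)
qed

text \<open>Zorn's lemma gives a minimal proper filter below \<open>G\<close>. If it decided neither \<open>P\<close> nor its
  negation, then intersecting it with \<open>{i. P i}\<close> would give a strictly smaller proper filter.\<close>

lemma ultra_exists:
  fixes G :: "'i filter"
  assumes "G \<noteq> bot"
  shows "\<exists>F. ultra F \<and> F \<le> G"
proof -
  define A where "A = {F :: 'i filter. F \<noteq> bot \<and> F \<le> G}"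
  have "\<exists>m\<in>A. \<forall>a\<in>A. a \<le> m \<longrightarrow> a = m"
  proof (rule predicate_Zorn[where P = "\<lambda>F F'. F' \<le> F"])
    show "partial_order_on A (relation_of (\<lambda>F F'. F' \<le> F) A)"
      by (rule partial_order_on_relation_ofI) auto
  next
    fix C assume C: "C \<in> Chains (relation_of (\<lambda>F F'. F' \<le> F) A)"
    then have CA: "C \<subseteq> A" and lin: "\<And>F F'. F \<in> C \<Longrightarrow> F' \<in> C \<Longrightarrow> F \<le> F' \<or> F' \<le> F"
      by (auto simp: Chains_def relation_of_def)
    show "\<exists>u\<in>A. \<forall>a\<in>C. u \<le> a"
    proof (cases "C = {}")
      case True
      then show ?thesis using assms by (auto simp: A_def)
    next
      case False
      have base: "\<exists>H\<in>C. H \<le> inf F F'" if "F \<in> C" "F' \<in> C" for F F'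
        using lin[OF that] that by (auto intro: le_infI)
      have "\<not> eventually (\<lambda>_. False) (Inf C)"
        using CA by (auto simp: eventually_Inf_base[OF False base] A_def trivial_limit_def)
      then have "Inf C \<noteq> bot"
        by (simp add: trivial_limit_def)
      moreover have "Inf C \<le> G"
        using False CA by (auto simp: A_def intro: Inf_lower2)
      ultimately show ?thesis
        by (intro bexI[of _ "Inf C"]) (auto simp: A_def intro: Inf_lower)
    qed
  qed
  then obtain F where F: "F \<noteq> bot" "F \<le> G" and min: "\<And>H. H \<noteq> bot \<Longrightarrow> H \<le> G \<Longrightarrow> H \<le> F \<Longrightarrow> H = F"
    by (auto simp: A_def)
  have "eventually P F \<or> eventually (\<lambda>i. \<not> P i) F" for P
  proof (cases "inf F (principal {i. P i}) = bot")
    case True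
    then have "eventually (\<lambda>_. False) (inf F (principal {i. P i}))"
      by simp
    then show ?thesis
      by (simp add: eventually_inf_principal)
  next
    case False
    then have "inf F (principal {i. P i}) = F"
      using min F(2) by (meson inf.cobounded1 order_trans)
    moreover have "eventually P (inf F (principal {i. P i}))"
      by (simp add: eventually_inf_principal)
    ultimately show ?thesis
      by simp
  qed
  then show ?thesis
    using F by (auto simp: ultra_def)
qed

text \<open>The combinatorial core of \<open>\<aleph>\<^sub>1\<close>-saturation of ultrapowers over the natural numbers. At index \<open>i\<close>
  one looks only at those conditions with number at most \<open>i\<close>, and takes a witness for the longest
  initial segment of them that can be met at \<open>i\<close>. Since the filter contains every final segment, each
  single condition is taken into account, and met, at almost every index.\<close>

lemma diagonal_witness:
  fixes F :: "nat filter" and P :: "nat \<Rightarrow> nat \<Rightarrow> 'a \<Rightarrow> bool"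
  assumes F: "F \<le> sequentially" and D: "D \<noteq> {}"
    and fin: "\<And>m. eventually (\<lambda>i. \<exists>x\<in>D. \<forall>k\<le>m. P k i x) F"
  shows "\<exists>d. (\<forall>i. d i \<in> D) \<and> (\<forall>k. eventually (\<lambda>i. P k i (d i)) F)"
proof -
  define G where "G m i \<longleftrightarrow> (\<exists>x\<in>D. \<forall>k\<le>m. P k i x)" for m i
  have "\<exists>x\<in>D. \<forall>m\<le>i. G m i \<longrightarrow> P m i x" for i
  proof (cases "\<exists>m\<le>i. G m i")
    case True
    define M where "M = Max {m. m \<le> i \<and> G m i}"
    have "finite {m. m \<le> i \<and> G m i}"
      by simp
    then have "G M i" "\<And>m. m \<le> i \<Longrightarrow> G m i \<Longrightarrow> m \<le> M"
      using True Max_in[of "{m. m \<le> i \<and> G m i}"] by (auto simp: M_def)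
    then show ?thesis
      unfolding G_def by blast
  next
    case False
    then show ?thesis
      using D by blast
  qed
  then obtain d where d: "\<And>i. d i \<in> D" "\<And>i m. m \<le> i \<Longrightarrow> G m i \<Longrightarrow> P m i (d i)"
    by metis
  have "eventually (\<lambda>i. P k i (d i)) F" for k
  proof -
    have "eventually (\<lambda>i. k \<le> i) F"
      using F by (rule filter_leD) (rule eventually_ge_at_top)
    then show ?thesis
      using fin[of k] by eventually_elim (rule d(2), auto simp: G_def)
  qed
  then show ?thesis
    using d(1) by blast
qed

section \<open>First-order logic\<close>

lemma finite_vars_trm: "finite (vars_trm t)"
  by (induction t) auto

lemma finite_free_vars: "finite (free_vars p)"
  by (induction p) (auto simp: finite_vars_trm)

lemma val_cong:
  "(\<And>x. x \<in> vars_trm t \<Longrightarrow> v x = w x) \<Longrightarrow> val A v t = val A w t"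
proof (induction t)
  case (Fun f ts)
  then have "map (val A v) ts = map (val A w) ts"
    by auto
  then show ?case
    by (metis val.simps(2))
qed simp

lemma sat_cong:
  "(\<And>x. x \<in> free_vars p \<Longrightarrow> v x = w x) \<Longrightarrow> sat A v p \<longleftrightarrow> sat A w p"
proof (induction p arbitrary: v w)
  case (Eq s t)
  then have "val A v s = val A w s" "val A v t = val A w t"
    by (auto intro: val_cong)
  then show ?case
    by simp
next
  case (Rel r ts)
  then have "val A v t = val A w t" if "t \<in> set ts" for t
    using that by (intro val_cong) auto
  then have "map (val A v) ts = map (val A w) ts"
    by simp
  then show ?case
    by (metis sat.simps(3))
next
  case (Imp p q)
  have "sat A v p = sat A w p" "sat A v q = sat A w q"
    by (rule Imp.IH; use Imp.prems in simp)+
  then show ?case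
    by simp
next
  case (All x p)
  have "sat A (v(x := a)) p = sat A (w(x := a)) p" for a
    by (rule All.IH) (use All.prems in auto)
  then show ?case
    by simp
qed simp

text \<open>The primitive connectives are falsity, implication and the universal quantifier; the
  existential quantifier and finite conjunctions are needed to say in one formula that finitely
  many formulas have a common solution.\<close>

definition form_Ex :: "nat \<Rightarrow> ('f, 'r) form \<Rightarrow> ('f, 'r) form" where
  "form_Ex x p = Imp (All x (Imp p Bot)) Bot"

definition form_Conj :: "('f, 'r) form list \<Rightarrow> ('f, 'r) form" where
  "form_Conj ps = foldr (\<lambda>p q. Imp (Imp p (Imp q Bot)) Bot) ps (Imp Bot Bot)"

lemma sat_form_Ex: "sat A v (form_Ex x p) \<longleftrightarrow> (\<exists>a\<in>universe A. sat A (v(x := a)) p)"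
  by (auto simp: form_Ex_def)

lemma sat_form_Conj: "sat A v (form_Conj ps) \<longleftrightarrow> (\<forall>p\<in>set ps. sat A v p)"
  by (induction ps) (auto simp: form_Conj_def)

lemma wf_form_Conj: "wf_form S (form_Conj ps) \<longleftrightarrow> (\<forall>p\<in>set ps. wf_form S p)"
  by (induction ps) (auto simp: form_Conj_def)

lemma free_vars_form_Conj: "free_vars (form_Conj ps) = (\<Union>p\<in>set ps. free_vars p)"
  by (induction ps) (auto simp: form_Conj_def)

instance trm :: (countable) countable
  by countable_datatype

instance form :: (countable, countable) countable
  by countable_datatype

lemma wf_trm_symbols: "wf_trm S t \<Longrightarrow> set_trm t \<subseteq> funs S"
  by (induction t) (auto simp: list_all_iff)

lemma wf_form_symbols: "wf_form S p \<Longrightarrow> set1_form p \<subseteq> funs S \<and> set2_form p \<subseteq> rels S"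
proof (induction p)
  case (Eq s t)
  then show ?case
    using wf_trm_symbols[of S s] wf_trm_symbols[of S t] by simp
next
  case (Rel r ts)
  then have "set_trm t \<subseteq> funs S" if "t \<in> set ts" for t
    using that by (intro wf_trm_symbols) (auto simp: list_all_iff)
  then show ?case
    using Rel by auto
qed auto

text \<open>The symbol types may be uncountable, so the symbols of the signature are first renamed to
  natural numbers; this renaming is injective on well-formed formulas.\<close>

lemma countable_wf_forms:
  assumes "countable_signature S"
  shows "countable {p. wf_form S p}"
proof -
  let ?c = "map_form (to_nat_on (funs S)) (to_nat_on (rels S))"
  have inj: "inj_on (to_nat_on (funs S)) (funs S)" "inj_on (to_nat_on (rels S)) (rels S)"
    using assms by (auto simp: countable_signature_def intro: inj_on_to_nat_on)
  have "inj_on ?c {p. wf_form S p}"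
  proof (rule inj_onI)
    fix p q assume "p \<in> {p. wf_form S p}" "q \<in> {p. wf_form S p}" and eq: "?c p = ?c q"
    then have p: "set1_form p \<subseteq> funs S" "set2_form p \<subseteq> rels S"
      and q: "set1_form q \<subseteq> funs S" "set2_form q \<subseteq> rels S"
      using wf_form_symbols by blast+
    show "p = q"
      by (rule form.inj_map_strong[OF _ _ eq]) (use p q inj in \<open>auto dest: inj_onD\<close>)
  qed
  then show ?thesis
    by (rule countableI')
qed

section \<open>Ultrapowers\<close>

text \<open>A choice of representatives for equality almost everywhere. With it the elements of an
  ultrapower are sequences again, and equality in the ultrapower is equality of functions, as the
  interpretation of \<^const>\<open>Eq\<close> demands.\<close>

definition rep :: "nat filter \<Rightarrow> (nat \<Rightarrow> 'a) \<Rightarrow> nat \<Rightarrow> 'a" where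
  "rep F f = (SOME g. eventually (\<lambda>i. f i = g i) F)"

lemma eventually_rep: "eventually (\<lambda>i. rep F f i = f i) F"
proof -
  have "eventually (\<lambda>i. f i = rep F f i) F"
    unfolding rep_def by (rule someI[of _ f]) simp
  then show ?thesis
    by (simp add: eq_commute)
qed

lemma rep_eq_iff: "rep F f = rep F g \<longleftrightarrow> eventually (\<lambda>i. f i = g i) F"
proof
  assume "rep F f = rep F g"
  then show "eventually (\<lambda>i. f i = g i) F"
    using eventually_rep[of F f] eventually_rep[of F g] by (auto elim: eventually_elim2)
next
  assume fg: "eventually (\<lambda>i. f i = g i) F"
  have "eventually (\<lambda>i. f i = h i) F \<longleftrightarrow> eventually (\<lambda>i. g i = h i) F" for h
  proof
    assume "eventually (\<lambda>i. f i = h i) F"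
    then show "eventually (\<lambda>i. g i = h i) F"
      using fg by eventually_elim simp
  next
    assume "eventually (\<lambda>i. g i = h i) F"
    then show "eventually (\<lambda>i. f i = h i) F"
      using fg by eventually_elim simp
  qed
  then show "rep F f = rep F g"
    by (simp add: rep_def)
qed

definition ultrapower ::
  "nat filter \<Rightarrow> ('f, 'r, 'a) struct \<Rightarrow> ('f, 'r, nat \<Rightarrow> 'a) struct" where
  "ultrapower F A = \<lparr>universe = rep F ` (UNIV \<rightarrow> universe A),
     fun_of = (\<lambda>f xs. rep F (\<lambda>i. fun_of A f (map (\<lambda>x. x i) xs))),
     rel_of = (\<lambda>r xs. eventually (\<lambda>i. rel_of A r (map (\<lambda>x. x i) xs)) F)\<rparr>"

lemma ultrapower_simps:
  "universe (ultrapower F A) = rep F ` (UNIV \<rightarrow> universe A)"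
  "fun_of (ultrapower F A) f xs = rep F (\<lambda>i. fun_of A f (map (\<lambda>x. x i) xs))"
  "rel_of (ultrapower F A) r xs \<longleftrightarrow> eventually (\<lambda>i. rel_of A r (map (\<lambda>x. x i) xs)) F"
  by (simp_all add: ultrapower_def)

lemma eventually_map_rep:
  "eventually (\<lambda>i. map (\<lambda>x. rep F (g x) i) xs = map (\<lambda>x. g x i) xs) F"
proof -
  have "eventually (\<lambda>i. \<forall>x\<in>set xs. rep F (g x) i = g x i) F"
    by (rule eventually_ball_finite) (auto intro: eventually_rep)
  then show ?thesis
    by eventually_elim simp
qed

lemma val_ultrapower:
  "val (ultrapower F A) (\<lambda>x. rep F (v x)) t = rep F (\<lambda>i. val A (\<lambda>x. v x i) t)"
proof (induction t)
  case (Fun f ts)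
  have "val (ultrapower F A) (\<lambda>x. rep F (v x)) (Fun f ts) =
      rep F (\<lambda>i. fun_of A f (map (\<lambda>t. rep F (\<lambda>i. val A (\<lambda>x. v x i) t) i) ts))"
    using Fun by (simp add: ultrapower_simps comp_def cong: map_cong)
  also have "\<dots> = rep F (\<lambda>i. fun_of A f (map (\<lambda>t. val A (\<lambda>x. v x i) t) ts))"
    unfolding rep_eq_iff
    using eventually_map_rep[of F "\<lambda>t i. val A (\<lambda>x. v x i) t" ts]
    by eventually_elim (rule arg_cong)
  finally show ?case
    by simp
qed simp

text \<open>The fundamental theorem of ultraproducts. The valuation is given by arbitrary sequences, of which
  the ultrapower sees the representatives; this form is stable under the updates of the valuation
  made by a quantifier.\<close>

lemma Los:
  assumes F: "ultra F"
  shows "sat (ultrapower F A) (\<lambda>x. rep F (v x)) p \<longleftrightarrow> eventually (\<lambda>i. sat A (\<lambda>x. v x i) p) F"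
proof (induction p arbitrary: v)
  case Bot
  then show ?case
    using F by (auto simp: ultra_def trivial_limit_def)
next
  case (Eq s t)
  show ?case
    by (simp add: val_ultrapower rep_eq_iff)
next
  case (Rel r ts)
  have ev: "eventually (\<lambda>i. map (\<lambda>t. rep F (\<lambda>i. val A (\<lambda>x. v x i) t) i) ts =
      map (\<lambda>t. val A (\<lambda>x. v x i) t) ts) F"
    by (rule eventually_map_rep)
  have "sat (ultrapower F A) (\<lambda>x. rep F (v x)) (Rel r ts) \<longleftrightarrow>
      eventually (\<lambda>i. rel_of A r (map (\<lambda>t. rep F (\<lambda>i. val A (\<lambda>x. v x i) t) i) ts)) F"
    by (simp add: val_ultrapower ultrapower_simps comp_def)
  also have "\<dots> \<longleftrightarrow> eventually (\<lambda>i. rel_of A r (map (\<lambda>t. val A (\<lambda>x. v x i) t) ts)) F"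
    by (rule eventually_cong[OF ev]) (simp only:)
  finally show ?case
    by simp
next
  case (Imp p q)
  then show ?case
    by (simp add: ultra_eventually_imp[OF F])
next
  case (All x p)
  have upd: "(\<lambda>y. rep F (v y))(x := rep F g) = (\<lambda>y. rep F ((v(x := g)) y))" for g
    by auto
  have upd': "(\<lambda>y. (v(x := g)) y i) = (\<lambda>y. v y i)(x := g i)" for g i
    by auto
  have "sat (ultrapower F A) (\<lambda>x. rep F (v x)) (All x p) \<longleftrightarrow>
      (\<forall>g \<in> UNIV \<rightarrow> universe A. eventually (\<lambda>i. sat A ((\<lambda>y. v y i)(x := g i)) p) F)"
    unfolding sat.simps upd'[symmetric] All.IH[symmetric]
    by (simp add: ultrapower_simps upd)
  also have "\<dots> \<longleftrightarrow> eventually (\<lambda>i. \<forall>a\<in>universe A. sat A ((\<lambda>y. v y i)(x := a)) p) F"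
  proof
    assume all: "\<forall>g \<in> UNIV \<rightarrow> universe A. eventually (\<lambda>i. sat A ((\<lambda>y. v y i)(x := g i)) p) F"
    show "eventually (\<lambda>i. \<forall>a\<in>universe A. sat A ((\<lambda>y. v y i)(x := a)) p) F"
    proof (cases "universe A = {}")
      case False
      \<comment> \<open>A counterexample at every index where there is one, as a single sequence.\<close>
      have "\<forall>i. \<exists>a\<in>universe A. sat A ((\<lambda>y. v y i)(x := a)) p \<longrightarrow>
          (\<forall>a\<in>universe A. sat A ((\<lambda>y. v y i)(x := a)) p)"
        using False by blast
      then obtain g where g: "\<And>i. g i \<in> universe A" "\<And>i. sat A ((\<lambda>y. v y i)(x := g i)) p \<Longrightarrow>
          \<forall>a\<in>universe A. sat A ((\<lambda>y. v y i)(x := a)) p"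
        by metis
      then have "eventually (\<lambda>i. sat A ((\<lambda>y. v y i)(x := g i)) p) F"
        using all by blast
      then show ?thesis
        by eventually_elim (rule g(2))
    qed simp
  next
    assume "eventually (\<lambda>i. \<forall>a\<in>universe A. sat A ((\<lambda>y. v y i)(x := a)) p) F"
    then show "\<forall>g \<in> UNIV \<rightarrow> universe A. eventually (\<lambda>i. sat A ((\<lambda>y. v y i)(x := g i)) p) F"
      by (auto elim!: eventually_mono)
  qed
  finally show ?case
    by simp
qed

lemma is_struct_ultrapower:
  assumes A: "is_struct S A"
  shows "is_struct S (ultrapower F A)"
  unfolding is_struct_def
proof (intro conjI ballI)
  show "universe (ultrapower F A) \<noteq> {}"
    using A by (auto simp: is_struct_def ultrapower_simps)
next
  fix f xs assume f: "f \<in> funs S" and xs: "xs \<in> tuples (universe (ultrapower F A)) (fun_arity S f)"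
  then have "\<forall>x\<in>set xs. \<exists>g. g \<in> UNIV \<rightarrow> universe A \<and> x = rep F g"
    by (auto simp: tuples_def ultrapower_simps)
  then obtain g where g: "\<And>x. x \<in> set xs \<Longrightarrow> g x \<in> UNIV \<rightarrow> universe A \<and> x = rep F (g x)"
    by metis
  have "fun_of (ultrapower F A) f xs = rep F (\<lambda>i. fun_of A f (map (\<lambda>x. g x i) xs))"
  proof -
    have "map (\<lambda>x. rep F (g x) i) xs = map (\<lambda>x. x i) xs" for i
      using g by (intro map_cong) auto
    then have "eventually (\<lambda>i. map (\<lambda>x. x i) xs = map (\<lambda>x. g x i) xs) F"
      using eventually_map_rep[of F g xs] by simp
    then have "eventually (\<lambda>i. fun_of A f (map (\<lambda>x. x i) xs) = fun_of A f (map (\<lambda>x. g x i) xs)) F"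
      by eventually_elim (rule arg_cong)
    then show ?thesis
      by (simp add: ultrapower_simps rep_eq_iff)
  qed
  moreover have "fun_of A f (map (\<lambda>x. g x i) xs) \<in> universe A" for i
  proof -
    have "map (\<lambda>x. g x i) xs \<in> tuples (universe A) (fun_arity S f)"
      using g xs by (fastforce simp: tuples_def)
    then show ?thesis
      using A f by (auto simp: is_struct_def)
  qed
  ultimately show "fun_of (ultrapower F A) f xs \<in> universe (ultrapower F A)"
    by (auto simp: ultrapower_simps)
qed

section \<open>Types of tuples\<close>

text \<open>A tuple is turned into a valuation of the variables \<open>0, 1, \<dots>\<close>; the default value \<open>z\<close> of the other
  variables is kept explicit, because it has to be moved along isomorphisms as well.\<close>

definition env :: "'a \<Rightarrow> 'a list \<Rightarrow> nat \<Rightarrow> 'a" where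
  "env z xs i = (if i < length xs then xs ! i else z)"

definition same_type :: "('f, 'r) signature \<Rightarrow> ('f, 'r, 'a) struct \<Rightarrow> 'a \<Rightarrow> 'a list \<Rightarrow> 'a list \<Rightarrow> bool" where
  "same_type S A z xs ys \<longleftrightarrow> length xs = length ys \<and>
     (\<forall>p. wf_form S p \<longrightarrow> free_vars p \<subseteq> {..<length xs} \<longrightarrow>
        (sat A (env z xs) p \<longleftrightarrow> sat A (env z ys) p))"

text \<open>The one-step extension property behind back-and-forth arguments; by symmetry it
  covers both directions.\<close>

definition homogeneous :: "('f, 'r) signature \<Rightarrow> ('f, 'r, 'a) struct \<Rightarrow> 'a \<Rightarrow> bool" where
  "homogeneous S A z \<longleftrightarrow> (\<forall>xs ys. \<forall>c\<in>universe A. set xs \<subseteq> universe A \<longrightarrow> set ys \<subseteq> universe A \<longrightarrow>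
     same_type S A z xs ys \<longrightarrow> (\<exists>d\<in>universe A. same_type S A z (xs @ [c]) (ys @ [d])))"

lemma env_snoc: "env z (xs @ [c]) = (env z xs)(length xs := c)"
  by (auto simp: env_def fun_eq_iff nth_append)

lemma env_map: "env (h z) (map h xs) = (\<lambda>i. h (env z xs i))"
  by (auto simp: env_def)

lemma range_env: "z \<in> X \<Longrightarrow> set xs \<subseteq> X \<Longrightarrow> range (env z xs) \<subseteq> X"
  by (auto simp: env_def)

lemma same_typeI:
  assumes "length xs = length ys"
    and "\<And>p. wf_form S p \<Longrightarrow> free_vars p \<subseteq> {..<length xs} \<Longrightarrow> sat A (env z xs) p \<Longrightarrow> sat A (env z ys) p"
  shows "same_type S A z xs ys"
  unfolding same_type_def
proof (intro conjI allI impI)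
  fix p assume p: "wf_form S p" "free_vars p \<subseteq> {..<length xs}"
  show "sat A (env z xs) p \<longleftrightarrow> sat A (env z ys) p"
    using assms(2)[of p] assms(2)[of "Imp p Bot"] p by auto
qed (rule assms(1))

lemma same_type_sym: "same_type S A z xs ys \<Longrightarrow> same_type S A z ys xs"
  by (auto simp: same_type_def)

text \<open>Let \<open>xs\<close> and \<open>ys\<close> have the same type and let \<open>c\<close> be given. The type of \<open>c\<close> over \<open>xs\<close> consists of
  countably many formulas. Any finitely many of them have a common solution over \<open>xs\<close>, namely \<open>c\<close>,
  and hence over \<open>ys\<close>, because solvability is part of the type. By saturation all of them have a
  common solution over \<open>ys\<close>.\<close>

lemma homogeneous_ultrapower:
  fixes A :: "('f, 'r, 'a) struct"
  assumes S: "countable_signature S" and A: "universe A \<noteq> {}"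
    and F: "ultra F" "F \<le> sequentially" and z: "z \<in> universe (ultrapower F A)"
  shows "homogeneous S (ultrapower F A) z"
  unfolding homogeneous_def
proof (intro allI ballI impI)
  let ?U = "ultrapower F A"
  fix xs ys c
  assume c: "c \<in> universe ?U" and xs: "set xs \<subseteq> universe ?U" and ys: "set ys \<subseteq> universe ?U"
    and type: "same_type S ?U z xs ys"
  let ?n = "length xs"
  \<comment> \<open>The complete type of \<open>xs\<close> extended by \<open>c\<close>; the new element is the value of variable \<open>?n\<close>.\<close>
  define \<Gamma> where "\<Gamma> = {p. wf_form S p \<and> free_vars p \<subseteq> {..<Suc ?n} \<and> sat ?U (env z (xs @ [c])) p}"
  have "Imp Bot Bot \<in> \<Gamma>"
    by (simp add: \<Gamma>_def)
  moreover have "countable \<Gamma>"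
    by (rule countable_subset[OF _ countable_wf_forms[OF S]]) (auto simp: \<Gamma>_def)
  ultimately obtain \<phi> :: "nat \<Rightarrow> ('f, 'r) form" where \<phi>: "range \<phi> = \<Gamma>"
    by (metis empty_iff range_from_nat_into)
  have "\<forall>i. \<exists>g. env z ys i = rep F g"
    using range_env[OF z ys] by (auto simp: ultrapower_simps image_subset_iff)
  then obtain v where v: "env z ys = (\<lambda>i. rep F (v i))"
    by metis
  have "\<exists>d. (\<forall>i. d i \<in> universe A) \<and>
      (\<forall>k. eventually (\<lambda>i. sat A ((\<lambda>x. v x i)(?n := d i)) (\<phi> k)) F)"
  proof (rule diagonal_witness[OF F(2) A])
    fix m
    define q where "q = form_Conj (map \<phi> [0..<Suc m])"
    have q: "wf_form S (form_Ex ?n q)" "free_vars (form_Ex ?n q) \<subseteq> {..<?n}"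
      using \<phi> by (force simp: q_def form_Ex_def wf_form_Conj free_vars_form_Conj \<Gamma>_def)+
    have "sat ?U (env z xs) (form_Ex ?n q)"
      unfolding sat_form_Ex q_def sat_form_Conj
      using \<phi> by (intro bexI[OF _ c]) (auto simp: env_snoc[symmetric] \<Gamma>_def)
    then have "sat ?U (env z ys) (form_Ex ?n q)"
      using type q by (simp add: same_type_def)
    then have "eventually (\<lambda>i. sat A (\<lambda>x. v x i) (form_Ex ?n q)) F"
      by (simp add: v Los[OF F(1)])
    then show "eventually (\<lambda>i. \<exists>x\<in>universe A. \<forall>k\<le>m. sat A ((\<lambda>x. v x i)(?n := x)) (\<phi> k)) F"
    proof eventually_elim
      case (elim i)
      then obtain a where "a \<in> universe A" "\<forall>k<Suc m. sat A ((\<lambda>x. v x i)(?n := a)) (\<phi> k)"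
        by (auto simp: sat_form_Ex q_def sat_form_Conj less_Suc_eq)
      then show ?case
        by (auto simp: less_Suc_eq_le)
    qed
  qed
  then obtain d where d: "\<And>i. d i \<in> universe A"
    and sat_d: "\<And>k. eventually (\<lambda>i. sat A ((\<lambda>x. v x i)(?n := d i)) (\<phi> k)) F"
    by blast
  have "sat ?U (env z (ys @ [rep F d])) (\<phi> k)" for k
  proof -
    have "env z (ys @ [rep F d]) = (\<lambda>x. rep F ((v(?n := d)) x))"
      using type by (auto simp: env_snoc v same_type_def)
    moreover have "(\<lambda>x. (v(?n := d)) x i) = (\<lambda>x. v x i)(?n := d i)" for i
      by auto
    ultimately show ?thesis
      using sat_d[of k] by (simp only: Los[OF F(1)])
  qed
  then have *: "sat ?U (env z (ys @ [rep F d])) p" if "p \<in> \<Gamma>" for p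
    using that \<phi> by (metis rangeE)
  have "same_type S ?U z (xs @ [c]) (ys @ [rep F d])"
    by (rule same_typeI) (use type * in \<open>auto simp: same_type_def \<Gamma>_def\<close>)
  moreover have "rep F d \<in> universe ?U"
    using d by (auto simp: ultrapower_simps)
  ultimately show "\<exists>d\<in>universe ?U. same_type S ?U z (xs @ [c]) (ys @ [d])"
    by blast
qed

section \<open>Countable elementary substructures\<close>

text \<open>Closing a countable set under countably many choice functions of finitely many arguments keeps it
  countable. The functions are chosen for arbitrary relations, so that the same lemma serves as a
  source of Skolem functions and of witnesses for homogeneity.\<close>

lemma countable_closure:
  fixes R :: "'j \<Rightarrow> 'u list \<Rightarrow> 'u \<Rightarrow> bool"
  assumes J: "countable J" and X: "countable X" "X \<subseteq> U"
  shows "\<exists>N. X \<subseteq> N \<and> N \<subseteq> U \<and> countable N \<and>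
    (\<forall>j\<in>J. \<forall>xs. set xs \<subseteq> N \<longrightarrow> (\<exists>y\<in>U. R j xs y) \<longrightarrow> (\<exists>y\<in>N. R j xs y))"
proof -
  define w where "w = (\<lambda>(j, xs). SOME y. y \<in> U \<and> R j xs y)"
  have w: "w (j, xs) \<in> U \<and> R j xs (w (j, xs))" if "\<exists>y\<in>U. R j xs y" for j xs
    unfolding w_def prod.case using someI_ex[of "\<lambda>y. y \<in> U \<and> R j xs y"] that by blast
  define step where
    "step Y = Y \<union> w ` {(j, xs) \<in> J \<times> lists Y. \<exists>y\<in>U. R j xs y}" for Y
  define Y where "Y n = (step ^^ n) X" for n
  have Y_Suc: "Y (Suc n) = step (Y n)" for n
    by (simp add: Y_def)
  have "incseq Y"
    by (rule incseq_SucI) (simp add: Y_Suc step_def)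
  have YU: "Y n \<subseteq> U" for n
  proof (induction n)
    case 0
    then show ?case using X by (simp add: Y_def)
  next
    case (Suc n)
    then show ?case using w by (auto simp: Y_Suc step_def)
  qed
  have cY: "countable (Y n)" for n
  proof (induction n)
    case 0
    then show ?case using X by (simp add: Y_def)
  next
    case (Suc n)
    have "countable {(j, xs) \<in> J \<times> lists (Y n). \<exists>y\<in>U. R j xs y}"
      by (rule countable_subset[of _ "J \<times> lists (Y n)"]) (use J Suc in auto)
    then show ?case using Suc by (simp add: Y_Suc step_def)
  qed
  have fin: "\<exists>n. set xs \<subseteq> Y n" if "set xs \<subseteq> (\<Union>n. Y n)" for xs
    using that
  proof (induction xs)
    case (Cons x xs)
    then obtain m n where "x \<in> Y m" "set xs \<subseteq> Y n"
      by auto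
    then have "set (x # xs) \<subseteq> Y (max m n)"
      using monoD[OF \<open>incseq Y\<close>, of m "max m n"] monoD[OF \<open>incseq Y\<close>, of n "max m n"] by auto
    then show ?case by blast
  qed simp
  have "\<exists>y\<in>(\<Union>n. Y n). R j xs y"
    if j: "j \<in> J" and xs: "set xs \<subseteq> (\<Union>n. Y n)" and ex: "\<exists>y\<in>U. R j xs y" for j xs
  proof -
    obtain n where "set xs \<subseteq> Y n"
      using fin[OF xs] by blast
    then have "(j, xs) \<in> {(j, xs) \<in> J \<times> lists (Y n). \<exists>y\<in>U. R j xs y}"
      using j ex by auto
    then have "w (j, xs) \<in> Y (Suc n)"
      unfolding Y_Suc step_def by blast
    then show ?thesis
      using w[OF ex] by blast
  qed
  moreover have "X \<subseteq> (\<Union>n. Y n)"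
    using UN_upper[of 0 UNIV Y] by (simp add: Y_def)
  ultimately show ?thesis
    using YU cY by (intro exI[of _ "\<Union>n. Y n"] conjI) (blast | simp)+
qed

lemma val_restrict: "val (A\<lparr>universe := N\<rparr>) v t = val A v t"
proof (induction t)
  case (Fun f ts)
  then show ?case by (simp cong: map_cong)
qed simp

text \<open>Agreement of the two structures can fail only at a quantifier, and there the witness condition,
  applied to the negated formula, says that a counterexample can be found in \<open>N\<close>.\<close>

lemma Tarski_Vaught:
  assumes N: "N \<subseteq> universe A"
    and witness: "\<And>p x v. wf_form S p \<Longrightarrow> range v \<subseteq> N \<Longrightarrow> \<exists>y\<in>universe A. sat A (v(x := y)) p \<Longrightarrow>
      \<exists>y\<in>N. sat A (v(x := y)) p"
  shows "wf_form S p \<Longrightarrow> range v \<subseteq> N \<Longrightarrow> sat (A\<lparr>universe := N\<rparr>) v p \<longleftrightarrow> sat A v p"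
proof (induction p arbitrary: v)
  case (Rel r ts)
  have "val (A\<lparr>universe := N\<rparr>) v = val A v"
    by (rule ext) (rule val_restrict)
  then show ?case
    by simp
next
  case (All x p)
  have "sat (A\<lparr>universe := N\<rparr>) (v(x := a)) p \<longleftrightarrow> sat A (v(x := a)) p" if "a \<in> N" for a
    using All that by (intro All.IH) auto
  then have "sat (A\<lparr>universe := N\<rparr>) v (All x p) \<longleftrightarrow> (\<forall>a\<in>N. sat A (v(x := a)) p)"
    by simp
  also have "\<dots> \<longleftrightarrow> (\<forall>a\<in>universe A. sat A (v(x := a)) p)"
    using witness[of "Imp p Bot" v x] All.prems N by auto
  finally show ?case
    by simp
qed (simp_all add: val_restrict)

text \<open>A downward Loewenheim-Skolem theorem that retains homogeneity: besides Skolem functions, the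
  closure uses functions that pick the extending element required by homogeneity. Types computed
  in the substructure and in the whole structure agree by elementarity, so the substructure is
  homogeneous as well.\<close>

lemma homogeneous_elementary_substructure:
  fixes A :: "('f, 'r, 'a) struct"
  assumes S: "countable_signature S" and A: "is_struct S A" and hom: "homogeneous S A z"
    and X: "countable X" "X \<subseteq> universe A" "z \<in> X"
  obtains N where "X \<subseteq> N" "N \<subseteq> universe A" "countable N" "is_struct S (A\<lparr>universe := N\<rparr>)"
    "homogeneous S (A\<lparr>universe := N\<rparr>) z"
    "\<And>p v. wf_form S p \<Longrightarrow> range v \<subseteq> N \<Longrightarrow> sat (A\<lparr>universe := N\<rparr>) v p \<longleftrightarrow> sat A v p"
proof -
  \<comment> \<open>The index \<open>Some (x, p)\<close> asks for solutions of \<open>p\<close> in the variable \<open>x\<close>, the index \<open>None\<close> for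
    homogeneity witnesses; its argument list packs an element and two tuples of equal length.\<close>
  define R where "R j ws y \<longleftrightarrow> (case j of
      Some (x, p) \<Rightarrow> sat A ((env z ws)(x := y)) p
    | None \<Rightarrow> \<exists>c xs ys. ws = c # xs @ ys \<and> length xs = length ys \<and>
        same_type S A z (xs @ [c]) (ys @ [y]))" for j :: "(nat \<times> ('f, 'r) form) option" and ws y
  define J where "J = insert None (Some ` ((UNIV :: nat set) \<times> {p. wf_form S p}))"
  have "countable J"
    unfolding J_def using countable_wf_forms[OF S]
    by (intro countable_insert countable_image countable_SIGMA countableI_type) auto
  from countable_closure[OF this X(1,2), of R] obtain N where N: "X \<subseteq> N" "N \<subseteq> universe A" "countable N"
    and cl: "\<And>j xs. j \<in> J \<Longrightarrow> set xs \<subseteq> N \<Longrightarrow> \<exists>y\<in>universe A. R j xs y \<Longrightarrow> \<exists>y\<in>N. R j xs y"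
    by blast
  have z: "z \<in> N"
    using N X by blast
  have witness: "\<exists>y\<in>N. sat A (v(x := y)) p"
    if p: "wf_form S p" and v: "range v \<subseteq> N" and y: "\<exists>y\<in>universe A. sat A (v(x := y)) p" for p x v
  proof -
    obtain n where n: "free_vars p \<subseteq> {..<n}"
      using finite_free_vars[of p] by (metis finite_nat_iff_bounded)
    have eq: "sat A ((env z (map v [0..<n]))(x := y)) p \<longleftrightarrow> sat A (v(x := y)) p" for y
      by (rule sat_cong) (use n in \<open>auto simp: env_def\<close>)
    have "\<exists>y\<in>N. R (Some (x, p)) (map v [0..<n]) y"
      by (rule cl) (use p v y eq in \<open>auto simp: J_def R_def\<close>)
    then show ?thesis
      by (simp add: R_def eq)
  qed
  note TV = Tarski_Vaught[OF N(2), of S, OF witness]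
  have "is_struct S (A\<lparr>universe := N\<rparr>)"
    unfolding is_struct_def
  proof (intro conjI ballI)
    show "universe (A\<lparr>universe := N\<rparr>) \<noteq> {}"
      using z by auto
  next
    fix f xs assume f: "f \<in> funs S" and xs: "xs \<in> tuples (universe (A\<lparr>universe := N\<rparr>)) (fun_arity S f)"
    define n where "n = fun_arity S f"
    \<comment> \<open>Closure under functions is the solvability of \<open>y = f(xs)\<close>.\<close>
    define p :: "('f, 'r) form" where "p = Eq (Var n) (Fun f (map Var [0..<n]))"
    have len: "length xs = n" "set xs \<subseteq> N"
      using xs by (auto simp: tuples_def n_def)
    have sat_p: "sat A ((env z xs)(n := y)) p \<longleftrightarrow> y = fun_of A f xs" for y
    proof -
      have "map (val A ((env z xs)(n := y)) \<circ> Var) [0..<n] = xs"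
        using len by (intro nth_equalityI) (auto simp: env_def)
      then show ?thesis
        by (simp add: p_def)
    qed
    have "fun_of A f xs \<in> universe A"
      using A f xs N(2) by (fastforce simp: is_struct_def tuples_def)
    then have "\<exists>y\<in>N. sat A ((env z xs)(n := y)) p"
      using witness[of p "env z xs" n] f range_env[OF z len(2)]
      by (auto simp: sat_p) (auto simp: p_def n_def list_all_iff)
    then show "fun_of (A\<lparr>universe := N\<rparr>) f xs \<in> universe (A\<lparr>universe := N\<rparr>)"
      by (simp add: sat_p)
  qed
  moreover have "homogeneous S (A\<lparr>universe := N\<rparr>) z"
    unfolding homogeneous_def
  proof (intro allI ballI impI)
    let ?N = "A\<lparr>universe := N\<rparr>"
    fix xs ys c
    assume "c \<in> universe ?N" "set xs \<subseteq> universe ?N" "set ys \<subseteq> universe ?N"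
      and type: "same_type S ?N z xs ys"
    then have sub: "c \<in> N" "set xs \<subseteq> N" "set ys \<subseteq> N"
      by auto
    have types: "same_type S ?N z us vs \<longleftrightarrow> same_type S A z us vs"
      if "set us \<subseteq> N" "set vs \<subseteq> N" for us vs
      using TV range_env[OF z that(1)] range_env[OF z that(2)] by (simp add: same_type_def cong: conj_cong)
    have "\<exists>d\<in>universe A. same_type S A z (xs @ [c]) (ys @ [d])"
      using hom[unfolded homogeneous_def, rule_format, of c xs ys] sub type N(2) types[OF sub(2,3)] by blast
    then have "\<exists>d\<in>N. R None (c # xs @ ys) d"
      using type sub by (intro cl) (auto simp: J_def R_def same_type_def)
    then obtain d us vs where d: "d \<in> N" "xs @ ys = us @ vs" "length us = length vs"
      "same_type S A z (us @ [c]) (vs @ [d])"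
      by (auto simp: R_def)
    moreover have "length xs = length us"
      using arg_cong[OF d(2), of length] d(3) type by (simp add: same_type_def)
    ultimately have "d \<in> N" "same_type S A z (xs @ [c]) (ys @ [d])"
      by auto
    then show "\<exists>d\<in>universe ?N. same_type S ?N z (xs @ [c]) (ys @ [d])"
      using sub by (auto simp: types)
  qed
  ultimately show ?thesis
    using N TV by (intro that[of N]) auto
qed

lemma isomorphism_homogeneous:
  assumes h: "embedding S A B h" "h ` universe A = universe B" and A: "is_struct S A"
    and z: "z \<in> universe A" and hom: "homogeneous S A z"
  shows "homogeneous S B (h z)"
  unfolding homogeneous_def
proof (intro allI ballI impI)
  have types: "same_type S B (h z) (map h us) (map h vs) \<longleftrightarrow> same_type S A z us vs"
    if "set us \<subseteq> universe A" "set vs \<subseteq> universe A" for us vs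
    using isomorphism_sat[OF h A _ range_env[OF z that(1)]] isomorphism_sat[OF h A _ range_env[OF z that(2)]]
    by (simp add: same_type_def env_map cong: conj_cong)
  fix xs ys c
  assume c: "c \<in> universe B" and xs: "set xs \<subseteq> universe B" and ys: "set ys \<subseteq> universe B"
    and type: "same_type S B (h z) xs ys"
  have "xs \<in> map h ` lists (universe A)" "ys \<in> map h ` lists (universe A)"
    using xs ys by (auto simp: lists_image[symmetric] h(2))
  then obtain us vs where us: "xs = map h us" "set us \<subseteq> universe A"
    and vs: "ys = map h vs" "set vs \<subseteq> universe A"
    by auto
  obtain a where a: "a \<in> universe A" "c = h a"
    using c h(2) by blast
  have "same_type S A z us vs"
    using type us vs by (simp add: types)
  then obtain b where b: "b \<in> universe A" "same_type S A z (us @ [a]) (vs @ [b])"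
    using hom us vs a unfolding homogeneous_def by blast
  then have "same_type S B (h z) (map h (us @ [a])) (map h (vs @ [b]))"
    using us vs a by (subst types) auto
  then have "same_type S B (h z) (xs @ [c]) (ys @ [h b])"
    by (simp add: us vs a)
  then show "\<exists>d\<in>universe B. same_type S B (h z) (xs @ [c]) (ys @ [d])"
    using b(1) h(2) by blast
qed

section \<open>Back and forth\<close>

lemma same_type_nth_eq_iff:
  assumes "same_type S A z xs ys" "i < length xs" "j < length xs"
  shows "xs ! i = xs ! j \<longleftrightarrow> ys ! i = ys ! j"
proof -
  have "wf_form S (Eq (Var i) (Var j))" "free_vars (Eq (Var i) (Var j)) \<subseteq> {..<length xs}"
    using assms by auto
  then have "sat A (env z xs) (Eq (Var i) (Var j)) \<longleftrightarrow> sat A (env z ys) (Eq (Var i) (Var j))"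
    using assms(1) unfolding same_type_def by blast
  then show ?thesis
    using assms by (simp add: env_def same_type_def)
qed

text \<open>Lets an atomic statement about entries of a tuple be read as a formula about the tuple, with the
  same variables for the image of the tuple under a map.\<close>

lemma env_index:
  assumes "set us \<subseteq> set xs"
  shows "\<exists>js. set js \<subseteq> {..<length xs} \<and> us = map (env z xs) js \<and> map f us = map (env z' (map f xs)) js"
proof -
  have "set xs = env z xs ` {..<length xs}"
    by (force simp: env_def set_conv_nth image_def)
  then have "us \<in> map (env z xs) ` lists {..<length xs}"
    using assms by (simp add: lists_image[symmetric] in_lists_conv_set subset_iff)
  then obtain js where "us = map (env z xs) js" "set js \<subseteq> {..<length xs}"
    by auto
  then show ?thesis
    by (intro exI[of _ js]) (auto simp: env_def)
qed

text \<open>Being an embedding is tested on atomic formulas, each involving finitely many elements. It therefore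
  suffices that every finite set is contained in some tuple whose type is preserved: the type of that
  tuple then gives all atomic formulas about its entries, in whatever order and with whatever
  repetitions they occur.\<close>

lemma locally_type_preserving_imp_embedding:
  assumes A: "is_struct S A" and f: "f \<in> universe A \<rightarrow> universe A"
    and local: "\<And>K. finite K \<Longrightarrow> K \<subseteq> universe A \<Longrightarrow>
      \<exists>xs. K \<subseteq> set xs \<and> set xs \<subseteq> universe A \<and> same_type S A z xs (map f xs)"
  shows "embedding S A A f"
  unfolding embedding_def
proof (intro conjI ballI)
  show "f \<in> universe A \<rightarrow> universe A"
    by (rule f)
  show "inj_on f (universe A)"
  proof (rule inj_onI)
    fix x y assume "x \<in> universe A" "y \<in> universe A" and eq: "f x = f y"
    then obtain xs where xs: "{x, y} \<subseteq> set xs" "same_type S A z xs (map f xs)"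
      using local[of "{x, y}"] by blast
    then obtain i j where "i < length xs" "xs ! i = x" "j < length xs" "xs ! j = y"
      by (auto simp: in_set_conv_nth)
    then show "x = y"
      using same_type_nth_eq_iff[OF xs(2), of i j] eq by simp
  qed
next
  fix r us assume r: "r \<in> rels S" and us: "us \<in> tuples (universe A) (rel_arity S r)"
  then obtain xs where xs: "set us \<subseteq> set xs" "same_type S A z xs (map f xs)"
    using local[of "set us"] by (auto simp: tuples_def)
  obtain js where js: "set js \<subseteq> {..<length xs}" "us = map (env z xs) js" "map f us = map (env z (map f xs)) js"
    using env_index[OF xs(1), of z f z] by blast
  let ?p = "Rel r (map Var js)"
  have "wf_form S ?p" "free_vars ?p \<subseteq> {..<length xs}"
    using r us js(1,2) by (auto simp: tuples_def list_all_iff)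
  then have "sat A (env z xs) ?p \<longleftrightarrow> sat A (env z (map f xs)) ?p"
    using xs(2) unfolding same_type_def by blast
  then show "rel_of A r us \<longleftrightarrow> rel_of A r (map f us)"
    by (simp add: js(3)) (simp add: js(2) comp_def)
next
  fix g us assume g: "g \<in> funs S" and us: "us \<in> tuples (universe A) (fun_arity S g)"
  define y where "y = fun_of A g us"
  have "y \<in> universe A"
    using A g us by (auto simp: is_struct_def y_def)
  then obtain xs where xs: "set us \<subseteq> set xs" "y \<in> set xs" "same_type S A z xs (map f xs)"
    using local[of "insert y (set us)"] us by (auto simp: tuples_def)
  obtain js where js: "set js \<subseteq> {..<length xs}" "us = map (env z xs) js" "map f us = map (env z (map f xs)) js"
    using env_index[OF xs(1), of z f z] by blast
  obtain i where i: "i < length xs" "env z xs i = y" "env z (map f xs) i = f y"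
    using xs(2) by (auto simp: in_set_conv_nth env_def)
  let ?p = "Eq (Fun g (map Var js)) (Var i)"
  have "wf_form S ?p" "free_vars ?p \<subseteq> {..<length xs}"
    using g us js(1,2) i by (auto simp: tuples_def list_all_iff)
  then have "sat A (env z xs) ?p \<longleftrightarrow> sat A (env z (map f xs)) ?p"
    using xs(3) unfolding same_type_def by blast
  then have "fun_of A g us = y \<longleftrightarrow> fun_of A g (map f us) = f y"
    by (simp add: js(3) i) (simp add: js(2) comp_def)
  then show "f (fun_of A g us) = fun_of A g (map f us)"
    by (simp add: y_def)
qed

text \<open>Back and forth. Starting with the pairs of corresponding entries of \<open>as\<close> and \<open>bs\<close>, one adds in step
  \<open>n\<close> a pair whose first component is the \<open>n\<close>-th element of the domain and a pair whose second component
  is, keeping the types of the two sides equal. The union of these finite sets of pairs is the graph of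
  an automorphism.\<close>

lemma homogeneous_automorphism:
  assumes A: "is_struct S A" and count: "countable (universe A)" and hom: "homogeneous S A z"
    and as: "set as \<subseteq> universe A" and bs: "set bs \<subseteq> universe A" and type: "same_type S A z as bs"
  shows "\<exists>g\<in>self_embeddings S A. g ` universe A = universe A \<and> map g as = bs"
proof -
  let ?D = "universe A"
  define Good where "Good ps \<longleftrightarrow> set ps \<subseteq> ?D \<times> ?D \<and> same_type S A z (map fst ps) (map snd ps)" for ps
  define e where "e = from_nat_into ?D"
  have "?D \<noteq> {}"
    using A by (simp add: is_struct_def)
  then have e: "range e = ?D"
    using count by (simp add: e_def)
  have forth: "\<exists>d. Good (ps @ [(c, d)])" if ps: "Good ps" and c: "c \<in> ?D" for ps c
  proof -
    have "set (map fst ps) \<subseteq> ?D" "set (map snd ps) \<subseteq> ?D"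
      using ps by (auto simp: Good_def)
    moreover have "same_type S A z (map fst ps) (map snd ps)"
      using ps by (simp add: Good_def)
    ultimately obtain d where "d \<in> ?D" "same_type S A z (map fst ps @ [c]) (map snd ps @ [d])"
      using hom[unfolded homogeneous_def, rule_format, OF c] by blast
    then show ?thesis
      using ps c by (auto simp: Good_def)
  qed
  have Good_swap: "Good (map prod.swap ps)" if "Good ps" for ps
    using that by (auto simp: Good_def comp_def dest: same_type_sym)
  have backward: "\<exists>c. Good (ps @ [(c, d)])" if ps: "Good ps" and d: "d \<in> ?D" for ps d
  proof -
    obtain c where "Good (map prod.swap ps @ [(d, c)])"
      using forth[OF Good_swap[OF ps] d] by blast
    from Good_swap[OF this] show ?thesis
      by (auto simp: comp_def)
  qed
  have step: "\<exists>qs. (Good qs \<and> set (zip as bs) \<subseteq> set qs) \<and>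
      (set ps \<subseteq> set qs \<and> e n \<in> fst ` set qs \<and> e n \<in> snd ` set qs)"
    if ps: "Good ps \<and> set (zip as bs) \<subseteq> set ps" for ps n
  proof -
    have en: "e n \<in> ?D"
      using e by blast
    obtain d where d: "Good (ps @ [(e n, d)])"
      using forth ps en by blast
    obtain c where "Good ((ps @ [(e n, d)]) @ [(c, e n)])"
      using backward[OF d en] by blast
    then show ?thesis
      using ps by (intro exI[of _ "(ps @ [(e n, d)]) @ [(c, e n)]"]) auto
  qed
  have "Good (zip as bs)"
    using as bs type by (auto simp: Good_def same_type_def dest: set_zip_leftD set_zip_rightD)
  then obtain ps where ps: "\<And>n. Good (ps n)" "\<And>n. set (zip as bs) \<subseteq> set (ps n)"
    "\<And>n. set (ps n) \<subseteq> set (ps (Suc n))" "\<And>n. e n \<in> fst ` set (ps (Suc n))" "\<And>n. e n \<in> snd ` set (ps (Suc n))"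
    using dependent_nat_choice[of "\<lambda>_ ps. Good ps \<and> set (zip as bs) \<subseteq> set ps"
        "\<lambda>n ps qs. set ps \<subseteq> set qs \<and> e n \<in> fst ` set qs \<and> e n \<in> snd ` set qs", OF _ step]
    by blast
  define G where "G = (\<Union>n. set (ps n))"
  have mono: "set (ps m) \<subseteq> set (ps n)" if "m \<le> n" for m n
    using that by (rule lift_Suc_mono_le[of "\<lambda>n. set (ps n)", OF ps(3)])
  have fin: "\<exists>n. K \<subseteq> set (ps n)" if "finite K" "K \<subseteq> G" for K
    using that
  proof (induction K)
    case (insert x K)
    then obtain m n where "x \<in> set (ps m)" "K \<subseteq> set (ps n)"
      by (auto simp: G_def)
    then have "insert x K \<subseteq> set (ps (max m n))"
      using mono[of m "max m n"] mono[of n "max m n"] by auto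
    then show ?case by blast
  qed simp
  have GD: "G \<subseteq> ?D \<times> ?D"
    using ps(1) by (auto simp: G_def Good_def)
  have unique: "y = y'" if xy: "(x, y) \<in> G" "(x, y') \<in> G" for x y y'
  proof -
    obtain n where "{(x, y), (x, y')} \<subseteq> set (ps n)"
      using fin[of "{(x, y), (x, y')}"] xy by auto
    then obtain i j where "i < length (ps n)" "ps n ! i = (x, y)" "j < length (ps n)" "ps n ! j = (x, y')"
      by (auto simp: in_set_conv_nth)
    then show ?thesis
      using same_type_nth_eq_iff[of S A z "map fst (ps n)" "map snd (ps n)" i j] ps(1)[of n]
      by (simp add: Good_def)
  qed
  have total: "?D \<subseteq> fst ` G" "?D \<subseteq> snd ` G"
    using ps(4,5) unfolding e[symmetric] G_def by blast+
  define g where "g = (\<lambda>x\<in>?D. THE y. (x, y) \<in> G)"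
  have g: "g x = y" if "(x, y) \<in> G" for x y
    using that GD unique by (auto simp: g_def intro!: the_equality)
  have g_ps: "map g (map fst (ps n)) = map snd (ps n)" for n
  proof -
    have "g (fst q) = snd q" if "q \<in> set (ps n)" for q
      by (rule g) (use that in \<open>auto simp: G_def\<close>)
    then show ?thesis
      by simp
  qed
  have maps: "g \<in> ?D \<rightarrow>\<^sub>E ?D"
  proof
    show "g x \<in> ?D" if "x \<in> ?D" for x
      using that total(1) g GD by force
    show "g x = undefined" if "x \<notin> ?D" for x
      using that by (simp add: g_def)
  qed
  have "embedding S A A g"
  proof (rule locally_type_preserving_imp_embedding[OF A])
    show "g \<in> ?D \<rightarrow> ?D"
      using maps by (auto simp: PiE_iff)
  next
    fix K assume K: "finite K" "K \<subseteq> ?D"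
    have "(\<lambda>x. (x, g x)) ` K \<subseteq> G"
      using K total(1) g by force
    then obtain n where n: "(\<lambda>x. (x, g x)) ` K \<subseteq> set (ps n)"
      using fin K(1) by blast
    have "K = fst ` (\<lambda>x. (x, g x)) ` K"
      by (simp add: image_image)
    then have "K \<subseteq> set (map fst (ps n))"
      using image_mono[OF n, of fst] by simp
    then show "\<exists>xs. K \<subseteq> set xs \<and> set xs \<subseteq> ?D \<and> same_type S A z xs (map g xs)"
      using ps(1)[of n] by (intro exI[of _ "map fst (ps n)"]) (auto simp: g_ps Good_def simp del: map_map)
  qed
  moreover have "g ` ?D = ?D"
  proof
    show "g ` ?D \<subseteq> ?D"
      using maps by auto
    show "?D \<subseteq> g ` ?D"
    proof
      fix y assume "y \<in> ?D"
      then obtain x where "(x, y) \<in> G"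
        using total(2) by force
      then show "y \<in> g ` ?D"
        using g GD by force
    qed
  qed
  moreover have "map g as = bs"
  proof (rule nth_equalityI)
    show len: "length (map g as) = length bs"
      using type by (simp add: same_type_def)
    fix i assume "i < length (map g as)"
    then have "(as ! i, bs ! i) \<in> set (zip as bs)"
      using len by (auto simp: in_set_zip)
    then have "(as ! i, bs ! i) \<in> G"
      using ps(2)[of 0] by (auto simp: G_def)
    then show "map g as ! i = bs ! i"
      using g \<open>i < length (map g as)\<close> by simp
  qed
  ultimately show ?thesis
    using maps by (intro bexI[of _ g]) (auto simp: self_embeddings_def)
qed

section \<open>A nonsurjective limit of automorphisms\<close>

lemma elementary_map_preserves_types:
  assumes elem: "\<And>p v. wf_form S p \<Longrightarrow> range v \<subseteq> universe A \<Longrightarrow> sat A v p \<longleftrightarrow> sat A (\<lambda>x. f (v x)) p"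
    and z: "z \<in> universe A" and xs: "set xs \<subseteq> universe A"
  shows "same_type S A z xs (map f xs)"
  unfolding same_type_def
proof (intro conjI allI impI)
  fix p assume p: "wf_form S p" "free_vars p \<subseteq> {..<length xs}"
  have "sat A (env z xs) p \<longleftrightarrow> sat A (\<lambda>x. f (env z xs x)) p"
    by (rule elem[OF p(1) range_env[OF z xs]])
  also have "\<dots> \<longleftrightarrow> sat A (env z (map f xs)) p"
    by (rule sat_cong) (use p(2) in \<open>auto simp: env_def\<close>)
  finally show "sat A (env z xs) p \<longleftrightarrow> sat A (env z (map f xs)) p" .
qed simp

text \<open>The ultrapower \<open>?U\<close> has a countable homogeneous elementary substructure \<open>?N\<close> that contains the
  diagonal copy of \<open>\<Delta>\<close> and some element outside it. It has the theory of \<open>\<Delta>\<close>, so \<open>\<omega>\<close>-categoricity gives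
  an isomorphism \<open>h\<close> from \<open>?N\<close> to \<open>\<Delta>\<close>. In this way \<open>\<Delta>\<close> inherits two properties: it is homogeneous, and
  \<open>h\<close> after the diagonal is an elementary self-map \<open>f\<close> that misses the image of that element. As
  \<open>f\<close> preserves types, homogeneity yields for each finite tuple an automorphism acting on it like \<open>f\<close>.\<close>

lemma nonsurjective_limit_of_automorphisms:
  fixes \<Delta> :: "('f, 'r, 'a) struct"
  assumes S: "countable_signature S" and \<Delta>: "is_struct S \<Delta>"
    and count: "countable (universe \<Delta>)" and inf: "infinite (universe \<Delta>)" and cat: "omega_categorical S \<Delta>"
  obtains f where "f \<in> self_embeddings S \<Delta>" "f ` universe \<Delta> \<noteq> universe \<Delta>"
    "\<And>K. finite K \<Longrightarrow> K \<subseteq> universe \<Delta> \<Longrightarrow>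
      \<exists>g\<in>self_embeddings S \<Delta>. g ` universe \<Delta> = universe \<Delta> \<and> (\<forall>x\<in>K. g x = f x)"
proof -
  let ?D = "universe \<Delta>"
  obtain F where F: "ultra F" "F \<le> sequentially"
    using ultra_exists[of sequentially] by auto
  let ?U = "ultrapower F \<Delta>"
  define diag where "diag a = rep F (\<lambda>_. a)" for a :: 'a
  \<comment> \<open>An injective sequence equals each constant sequence at most once, so it
    represents an element outside the diagonal.\<close>
  obtain e :: "nat \<Rightarrow> 'a" where e: "inj e" "range e \<subseteq> ?D"
    using inf infinite_countable_subset by blast
  have diag_sat: "sat ?U (\<lambda>x. diag (v x)) p \<longleftrightarrow> sat \<Delta> v p" for v p
    using Los[OF F(1), of \<Delta> "\<lambda>x _. v x" p] F(1) by (auto simp: diag_def ultra_def eventually_const)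
  have new: "rep F e \<noteq> diag a" for a
  proof
    assume "rep F e = diag a"
    then have "eventually (\<lambda>i. e i = a) F"
      by (simp add: diag_def rep_eq_iff)
    moreover have "eventually (\<lambda>i. e i \<noteq> a) F"
    proof (rule filter_leD[OF F(2)])
      have "finite {i. e i = a}"
        using finite_vimageI[OF _ e(1), of "{a}"] by (simp add: vimage_def)
      then show "eventually (\<lambda>i. e i \<noteq> a) sequentially"
        unfolding cofinite_eq_sequentially[symmetric] eventually_cofinite by simp
    qed
    ultimately have "eventually (\<lambda>_. False) F"
      by eventually_elim simp
    then show False
      using F(1) by (simp add: ultra_def trivial_limit_def)
  qed
  obtain a where a: "a \<in> ?D"
    using \<Delta> by (auto simp: is_struct_def)
  have diagU: "diag c \<in> universe ?U" if "c \<in> ?D" for c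
    using that by (auto simp: diag_def ultrapower_simps)
  have "rep F e \<in> universe ?U"
    using e by (auto simp: ultrapower_simps)
  moreover have "homogeneous S ?U (diag a)"
    using homogeneous_ultrapower[OF S _ F diagU[OF a]] a by blast
  ultimately obtain N where N: "insert (rep F e) (diag ` ?D) \<subseteq> N" "N \<subseteq> universe ?U" "countable N"
    and str: "is_struct S (?U\<lparr>universe := N\<rparr>)" and hom: "homogeneous S (?U\<lparr>universe := N\<rparr>) (diag a)"
    and elem: "\<And>p v. wf_form S p \<Longrightarrow> range v \<subseteq> N \<Longrightarrow> sat (?U\<lparr>universe := N\<rparr>) v p \<longleftrightarrow> sat ?U v p"
    using homogeneous_elementary_substructure[OF S is_struct_ultrapower[OF \<Delta>, of F],
        of "diag a" "insert (rep F e) (diag ` ?D)"] count a diagU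
    by (auto simp: image_subset_iff)
  let ?N = "?U\<lparr>universe := N\<rparr>"
  have "holds ?N p" if p: "p \<in> theory_of S \<Delta>" for p
    unfolding holds_def
  proof (intro allI impI)
    fix v :: "nat \<Rightarrow> nat \<Rightarrow> 'a" assume v: "range v \<subseteq> universe ?N"
    have wf: "wf_form S p" and closed: "free_vars p = {}"
      using p by (auto simp: theory_of_def sentence_def)
    have "sat \<Delta> (\<lambda>_. a) p"
      using p a by (auto simp: theory_of_def holds_def)
    then have "sat ?U (\<lambda>_. diag a) p"
      using diag_sat[of "\<lambda>_. a"] by simp
    then have "sat ?U v p"
      using sat_cong[of p v "\<lambda>_. diag a"] closed by simp
    then show "sat ?N v p"
      using elem[OF wf, of v] v by simp
  qed
  then have "is_model S (theory_of S \<Delta>) ?N"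
    using str by (simp add: is_model_def)
  then have "isomorphic S ?N \<Delta>"
    by (rule omega_categorical_isomorphic[OF cat]) (simp add: N(3))
  then obtain h where h: "embedding S ?N \<Delta> h" "h ` universe ?N = universe \<Delta>"
    by (auto simp: isomorphic_def)
  have hom_\<Delta>: "homogeneous S \<Delta> (h (diag a))"
    by (rule isomorphism_homogeneous[OF h str _ hom]) (use N(1) a in auto)
  have inj_h: "inj_on h N"
    using h(1) by (simp add: embedding_def)
  have hN: "h ` N = ?D"
    using h(2) by simp
  have diagN: "diag c \<in> N" if "c \<in> ?D" for c
    using N(1) that by auto
  define f where "f = (\<lambda>c\<in>?D. h (diag c))"
  have maps: "f \<in> ?D \<rightarrow>\<^sub>E ?D"
    using diagN hN by (auto simp: f_def)
  have f_elem: "sat \<Delta> v p \<longleftrightarrow> sat \<Delta> (\<lambda>x. f (v x)) p" if wf: "wf_form S p" and v: "range v \<subseteq> ?D" for p v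
  proof -
    have vN: "range (\<lambda>x. diag (v x)) \<subseteq> N"
      using v diagN by auto
    have "sat \<Delta> v p \<longleftrightarrow> sat ?N (\<lambda>x. diag (v x)) p"
      using elem[OF wf vN] by (simp add: diag_sat)
    also have "\<dots> \<longleftrightarrow> sat \<Delta> (\<lambda>x. h (diag (v x))) p"
      using isomorphism_sat[OF h str wf, of "\<lambda>x. diag (v x)"] vN by simp
    also have "(\<lambda>x. h (diag (v x))) = (\<lambda>x. f (v x))"
      using v by (auto simp: f_def image_subset_iff)
    finally show ?thesis .
  qed
  let ?z = "h (diag a)"
  have z: "?z \<in> ?D"
    using diagN[OF a] hN by blast
  have fD: "f \<in> ?D \<rightarrow> ?D"
    using maps by (auto simp: PiE_iff)
  have type: "same_type S \<Delta> ?z xs (map f xs)" if "set xs \<subseteq> ?D" for xs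
    by (rule elementary_map_preserves_types[OF f_elem z that])
  have lists: "\<exists>xs. set xs = K" if "finite K" for K :: "'a set"
    using finite_list[OF that] .
  have "embedding S \<Delta> \<Delta> f"
    by (rule locally_type_preserving_imp_embedding[OF \<Delta> fD]) (use type lists in blast)
  then have "f \<in> self_embeddings S \<Delta>"
    using maps by (simp add: self_embeddings_def)
  moreover have "f ` ?D \<noteq> ?D"
  proof
    assume "f ` ?D = ?D"
    moreover have "h (rep F e) \<in> ?D"
      using N(1) hN by blast
    ultimately obtain c where c: "c \<in> ?D" "h (rep F e) = h (diag c)"
      by (auto simp: f_def)
    then have "rep F e = diag c"
      using inj_onD[OF inj_h] N(1) diagN by simp
    then show False
      using new by blast
  qed
  moreover have "\<exists>g\<in>self_embeddings S \<Delta>. g ` ?D = ?D \<and> (\<forall>x\<in>K. g x = f x)"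
    if K: "finite K" "K \<subseteq> ?D" for K
  proof -
    obtain xs where xs: "set xs = K"
      using lists[OF K(1)] by blast
    have "set (map f xs) \<subseteq> ?D"
      using xs K fD by auto
    then obtain g where "g \<in> self_embeddings S \<Delta>" "g ` ?D = ?D" "map g xs = map f xs"
      using homogeneous_automorphism[OF \<Delta> count hom_\<Delta>, of xs "map f xs"] type[of xs] xs K by blast
    then show ?thesis
      using xs by auto
  qed
  ultimately show ?thesis
    by (rule that)
qed

section \<open>The topology of pointwise convergence\<close>

lemma openin_pointwise:
  "openin (pointwise D) X \<longleftrightarrow> X \<subseteq> D \<rightarrow>\<^sub>E D \<and>
    (\<forall>f\<in>X. \<exists>K. finite K \<and> K \<subseteq> D \<and> (\<forall>g\<in>D \<rightarrow>\<^sub>E D. (\<forall>x\<in>K. g x = f x) \<longrightarrow> g \<in> X))"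
proof (intro iffI conjI ballI)
  assume X: "openin (pointwise D) X"
  show "X \<subseteq> D \<rightarrow>\<^sub>E D"
    using openin_subset[OF X] by (simp add: pointwise_def)
  fix f assume "f \<in> X"
  then obtain U where U: "finite {i \<in> D. U i \<noteq> D}" "\<forall>i\<in>D. U i \<subseteq> D" "f \<in> Pi\<^sub>E D U" "Pi\<^sub>E D U \<subseteq> X"
    using X unfolding pointwise_def openin_product_topology_alt by auto
  have "g \<in> X" if "g \<in> D \<rightarrow>\<^sub>E D" "\<forall>x\<in>{i \<in> D. U i \<noteq> D}. g x = f x" for g
  proof -
    have "g \<in> Pi\<^sub>E D U"
    proof (rule PiE_I)
      fix x assume "x \<in> D"
      then show "g x \<in> U x"
        using that U(3) by (cases "U x = D") auto
    qed (use that in auto)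
    then show ?thesis
      using U(4) by blast
  qed
  then show "\<exists>K. finite K \<and> K \<subseteq> D \<and> (\<forall>g\<in>D \<rightarrow>\<^sub>E D. (\<forall>x\<in>K. g x = f x) \<longrightarrow> g \<in> X)"
    using U(1) by (intro exI[of _ "{i \<in> D. U i \<noteq> D}"]) auto
next
  assume X: "X \<subseteq> D \<rightarrow>\<^sub>E D \<and>
    (\<forall>f\<in>X. \<exists>K. finite K \<and> K \<subseteq> D \<and> (\<forall>g\<in>D \<rightarrow>\<^sub>E D. (\<forall>x\<in>K. g x = f x) \<longrightarrow> g \<in> X))"
  show "openin (pointwise D) X"
    unfolding pointwise_def openin_product_topology_alt
  proof
    fix f assume f: "f \<in> X"
    from bspec[OF conjunct2[OF X] this]
    obtain K where K: "finite K" "K \<subseteq> D" "\<And>g. g \<in> D \<rightarrow>\<^sub>E D \<Longrightarrow> \<forall>x\<in>K. g x = f x \<Longrightarrow> g \<in> X"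
      by auto
    have fD: "f \<in> D \<rightarrow>\<^sub>E D"
      using f X by blast
    define U where "U i = (if i \<in> K then {f i} else D)" for i
    have "finite {i \<in> D. U i \<noteq> D}"
      by (rule finite_subset[OF _ K(1)]) (auto simp: U_def)
    moreover have "\<forall>i\<in>D. U i \<subseteq> D" "f \<in> Pi\<^sub>E D U"
      using fD K(2) by (auto simp: U_def PiE_iff)
    moreover have "Pi\<^sub>E D U \<subseteq> X"
    proof
      fix g assume g: "g \<in> Pi\<^sub>E D U"
      have "U i \<subseteq> D" if "i \<in> D" for i
        using that fD by (auto simp: U_def)
      then have "g \<in> D \<rightarrow>\<^sub>E D"
        using g by (auto simp: PiE_iff)
      moreover have "\<forall>x\<in>K. g x = f x"
        using g K(2) by (fastforce simp: PiE_iff U_def split: if_splits)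
      ultimately show "g \<in> X"
        by (rule K(3))
    qed
    ultimately show "\<exists>U. finite {i \<in> D. U i \<noteq> topspace (discrete_topology D)} \<and>
        (\<forall>i\<in>D. openin (discrete_topology D) (U i)) \<and> f \<in> Pi\<^sub>E D U \<and> Pi\<^sub>E D U \<subseteq> X"
      by (intro exI[of _ U]) simp
  qed
qed

lemma closedin_pointwiseI:
  assumes M: "M \<subseteq> D \<rightarrow>\<^sub>E D"
    and limit: "\<And>f. f \<in> D \<rightarrow>\<^sub>E D \<Longrightarrow>
      (\<And>K. finite K \<Longrightarrow> K \<subseteq> D \<Longrightarrow> \<exists>g\<in>M. \<forall>x\<in>K. g x = f x) \<Longrightarrow> f \<in> M"
  shows "closedin (pointwise D) M"
proof -
  have top: "topspace (pointwise D) = D \<rightarrow>\<^sub>E D"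
    by (simp add: pointwise_def)
  have "\<exists>K. finite K \<and> K \<subseteq> D \<and> (\<forall>g\<in>D \<rightarrow>\<^sub>E D. (\<forall>x\<in>K. g x = f x) \<longrightarrow> g \<in> (D \<rightarrow>\<^sub>E D) - M)"
    if f: "f \<in> (D \<rightarrow>\<^sub>E D) - M" for f
  proof -
    have "\<not> (\<forall>K. finite K \<longrightarrow> K \<subseteq> D \<longrightarrow> (\<exists>g\<in>M. \<forall>x\<in>K. g x = f x))"
      using limit[of f] f by blast
    then show ?thesis
      by blast
  qed
  then show ?thesis
    unfolding closedin_def top openin_pointwise using M by blast
qed

section \<open>Self-embeddings\<close>

text \<open>Each instance of a condition defining embeddings involves finitely many arguments and
  is therefore passed on to pointwise limits.\<close>

lemma closed_submonoid_self_embeddings: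
  fixes A :: "('f, 'r, 'a) struct"
  assumes A: "is_struct S A"
  shows "closed_submonoid (universe A) (self_embeddings S A)"
  unfolding closed_submonoid_def
proof
  let ?D = "universe A"
  have fun_closed: "fun_of A f xs \<in> ?D" if "f \<in> funs S" "xs \<in> tuples ?D (fun_arity S f)" for f xs
    using A that by (auto simp: is_struct_def)
  have restrict: "map (restrict f ?D) xs = map f xs" if "xs \<in> tuples ?D n" for f :: "'a \<Rightarrow> 'a" and xs n
    using that by (auto simp: tuples_def)
  \<comment> \<open>The condition for a function symbol evaluates the map only inside the domain, since the
    structure is closed under its functions; hence restricting to the domain is harmless.\<close>
  have emb_restrict: "embedding S A A (restrict f ?D)" if "embedding S A A f" for f
    using that by (auto simp: embedding_def restrict fun_closed inj_on_restrict_eq)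
  show "submonoid (self_embeddings S A) (self_maps ?D)"
  proof
    show "self_embeddings S A \<subseteq> carrier (self_maps ?D)"
      by (auto simp: self_embeddings_def self_maps_def)
  next
    fix f g assume "f \<in> self_embeddings S A" "g \<in> self_embeddings S A"
    then have "embedding S A A (restrict (f \<circ> g) ?D)"
      by (auto simp: self_embeddings_def intro: emb_restrict embedding_compose)
    moreover have "restrict (f \<circ> g) ?D = compose ?D f g"
      by (auto simp: compose_def)
    moreover have "h \<in> self_embeddings S A" if "embedding S A A h" "h \<in> extensional ?D" for h
      using that by (simp add: self_embeddings_def embedding_def PiE_def)
    ultimately show "f \<otimes>\<^bsub>self_maps ?D\<^esub> g \<in> self_embeddings S A"
      by (simp add: self_maps_def)
  next
    have "embedding S A A (restrict (\<lambda>x. x) ?D)"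
      by (rule emb_restrict) (auto simp: embedding_def)
    then show "\<one>\<^bsub>self_maps ?D\<^esub> \<in> self_embeddings S A"
      by (auto simp: self_embeddings_def self_maps_def)
  qed
  show "closedin (pointwise ?D) (self_embeddings S A)"
  proof (rule closedin_pointwiseI)
    show "self_embeddings S A \<subseteq> ?D \<rightarrow>\<^sub>E ?D"
      by (auto simp: self_embeddings_def)
  next
    fix f assume f: "f \<in> ?D \<rightarrow>\<^sub>E ?D"
      and limit: "\<And>K. finite K \<Longrightarrow> K \<subseteq> ?D \<Longrightarrow> \<exists>g\<in>self_embeddings S A. \<forall>x\<in>K. g x = f x"
    have approx: "\<exists>g. embedding S A A g \<and> (\<forall>x\<in>K. g x = f x)" if "finite K" "K \<subseteq> ?D" for K
      using limit[OF that] by (auto simp: self_embeddings_def)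
    have "embedding S A A f"
      unfolding embedding_def
    proof (intro conjI ballI)
      show "f \<in> ?D \<rightarrow> ?D"
        using f by (auto simp: PiE_iff)
      show "inj_on f ?D"
      proof (rule inj_onI)
        fix x y assume xy: "x \<in> ?D" "y \<in> ?D" "f x = f y"
        then obtain g where "embedding S A A g" "g x = f x" "g y = f y"
          using approx[of "{x, y}"] by auto
        then show "x = y"
          using xy unfolding embedding_def by (metis inj_onD)
      qed
    next
      fix k xs assume k: "k \<in> funs S" and xs: "xs \<in> tuples ?D (fun_arity S k)"
      obtain g where g: "embedding S A A g" "\<forall>x\<in>insert (fun_of A k xs) (set xs). g x = f x"
        using approx[of "insert (fun_of A k xs) (set xs)"] fun_closed[OF k xs] xs by (auto simp: tuples_def)
      then have "map g xs = map f xs"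
        by simp
      then show "f (fun_of A k xs) = fun_of A k (map f xs)"
        using g k xs unfolding embedding_def by (metis insertI1)
    next
      fix r xs assume r: "r \<in> rels S" and xs: "xs \<in> tuples ?D (rel_arity S r)"
      obtain g where g: "embedding S A A g" "\<forall>x\<in>set xs. g x = f x"
        using approx[of "set xs"] xs by (auto simp: tuples_def)
      then have "map g xs = map f xs"
        by simp
      then show "rel_of A r xs \<longleftrightarrow> rel_of A r (map f xs)"
        using g r xs unfolding embedding_def by metis
    qed
    then show "f \<in> self_embeddings S A"
      using f by (simp add: self_embeddings_def)
  qed
qed

text \<open>A composition of injective self-maps is surjective only if both factors are. Hence sending the
  surjective members of \<open>M\<close> to the identity and the others to the map with constant value \<open>a\<close>, which is
  idempotent, is a homomorphism. It is not continuous at a nonsurjective \<open>f\<close>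
  that is a limit of surjective members: the value at \<open>f\<close> sends \<open>b\<close> to \<open>a\<close>, while the values at the approximating maps fix \<open>b\<close>.\<close>

lemma not_automatic_continuity:
  assumes M: "M \<subseteq> D \<rightarrow>\<^sub>E D" and inj: "\<And>f. f \<in> M \<Longrightarrow> inj_on f D"
    and ab: "a \<in> D" "b \<in> D" "a \<noteq> b"
    and f: "f \<in> M" "f ` D \<noteq> D"
    and limit: "\<And>K. finite K \<Longrightarrow> K \<subseteq> D \<Longrightarrow> \<exists>g\<in>M. g ` D = D \<and> (\<forall>x\<in>K. g x = f x)"
  shows "\<not> automatic_continuity D M"
proof
  assume cont: "automatic_continuity D M"
  define \<phi> where "\<phi> g = (if g ` D = D then (\<lambda>x\<in>D. x) else (\<lambda>x\<in>D. a))" for g :: "'a \<Rightarrow> 'a"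
  have surj_compose: "compose D g h ` D = D \<longleftrightarrow> g ` D = D \<and> h ` D = D" if "g \<in> M" "h \<in> M" for g h
  proof -
    have im: "compose D g h ` D = g ` h ` D"
      by (auto simp: compose_def image_image)
    have sub: "g ` D \<subseteq> D" "h ` D \<subseteq> D"
      using that M by auto
    show ?thesis
    proof
      assume eq: "compose D g h ` D = D"
      then have "g ` D = D"
        using sub unfolding im by blast
      moreover from this have "g ` h ` D = g ` D"
        using eq im by simp
      then have "h ` D = D"
        using inj_on_image_eq_iff[OF inj[OF that(1)] sub(2) order_refl] by simp
      ultimately show "g ` D = D \<and> h ` D = D" ..
    qed (simp add: im)
  qed
  have "\<phi> \<in> monoid_homs (self_maps D\<lparr>carrier := M\<rparr>) (self_maps D)"
  proof -
    have "\<phi> (compose D g h) = compose D (\<phi> g) (\<phi> h)" if "g \<in> M" "h \<in> M" for g h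
      unfolding \<phi>_def surj_compose[OF that] using ab(1) by (auto simp: compose_def)
    then show ?thesis
      using ab(1) by (auto simp: monoid_homs_def hom_def self_maps_def \<phi>_def)
  qed
  then have c: "continuous_map (subtopology (pointwise D) M) (pointwise D) \<phi>"
    using cont by (simp add: automatic_continuity_def)
  have "openin (pointwise D) {h \<in> D \<rightarrow>\<^sub>E D. h b = a}"
    unfolding openin_pointwise
  proof (intro conjI ballI)
    fix h assume "h \<in> {h \<in> D \<rightarrow>\<^sub>E D. h b = a}"
    then show "\<exists>K. finite K \<and> K \<subseteq> D \<and>
        (\<forall>g\<in>D \<rightarrow>\<^sub>E D. (\<forall>x\<in>K. g x = h x) \<longrightarrow> g \<in> {h \<in> D \<rightarrow>\<^sub>E D. h b = a})"
      using ab(2) by (intro exI[of _ "{b}"]) auto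
  qed auto
  from openin_continuous_map_preimage[OF c this]
  obtain X where X: "openin (pointwise D) X"
    and pre: "{g \<in> M. \<phi> g \<in> D \<rightarrow>\<^sub>E D \<and> \<phi> g b = a} = X \<inter> M"
    using M by (auto simp: openin_subtopology topspace_subtopology pointwise_def Int_absorb1)
  have "\<phi> f = (\<lambda>x\<in>D. a)"
    using f(2) by (simp add: \<phi>_def)
  then have "f \<in> {g \<in> M. \<phi> g \<in> D \<rightarrow>\<^sub>E D \<and> \<phi> g b = a}"
    using f(1) ab by simp
  then have "f \<in> X"
    unfolding pre by blast
  then obtain K where K: "finite K" "K \<subseteq> D" "\<And>g. g \<in> D \<rightarrow>\<^sub>E D \<Longrightarrow> \<forall>x\<in>K. g x = f x \<Longrightarrow> g \<in> X"
    using X[unfolded openin_pointwise, THEN conjunct2, THEN bspec, of f] by auto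
  obtain g where g: "g \<in> M" "g ` D = D" "\<forall>x\<in>K. g x = f x"
    using limit[OF K(1,2)] by blast
  then have "g \<in> X \<inter> M"
    using K(3) M by blast
  then have "\<phi> g b = a"
    unfolding pre[symmetric] by blast
  then show False
    using g(2) ab by (simp add: \<phi>_def)
qed

theorem corollary10:
  fixes S :: "('f, 'r) signature" and \<Delta> :: "('f, 'r, 'a) struct" and D :: "'a set"
  assumes "countable_signature S"
    and "is_struct S \<Delta>"
    and "universe \<Delta> = D" and "countable D" and "infinite D"
    and "omega_categorical S \<Delta>"
  shows "closed_submonoid D (self_embeddings S \<Delta>) \<and>
    \<not> automatic_continuity D (self_embeddings S \<Delta>)"
proof
  show "closed_submonoid D (self_embeddings S \<Delta>)"
    using closed_submonoid_self_embeddings[OF assms(2)] assms(3) by simp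
  obtain f where f: "f \<in> self_embeddings S \<Delta>" "f ` D \<noteq> D"
    "\<And>K. finite K \<Longrightarrow> K \<subseteq> D \<Longrightarrow> \<exists>g\<in>self_embeddings S \<Delta>. g ` D = D \<and> (\<forall>x\<in>K. g x = f x)"
    using nonsurjective_limit_of_automorphisms[OF assms(1,2) _ _ assms(6)] assms(3-5) by metis
  obtain a where a: "a \<in> D"
    using assms(5) by (metis ex_in_conv finite.emptyI)
  obtain b where b: "b \<in> D" "a \<noteq> b"
    using assms(5) by (metis finite.emptyI finite_insert finite_subset singleton_iff subsetI)
  show "\<not> automatic_continuity D (self_embeddings S \<Delta>)"
    by (rule not_automatic_continuity[OF _ _ a b f])
      (auto simp: self_embeddings_def embedding_def assms(3))
qed

end
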